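(* Let $(W,S)$ be a finite Coxeter system with a positive weight function $L$, and assume that Lusztig's statements P1-P15 hold for $(W,L)$. If $\mathfrak{C}$ and $\mathfrak{C}'$ are two Kazhdan-Lusztig left cells in $W$ with respect to $L$, then $$\dim\mathrm{Hom}_W([\mathfrak{C}],[\mathfrak{C}'])=|\mathfrak{C}\cap\mathfrak{C}'^{-1}|,$$ where $\mathfrak{C}'^{-1}=\{x^{-1}\mid x\in\mathfrak{C}'\}$.
   Context: **Hecke algebra and cells.** $(W,S)$ has length function $\ell$; a weight function $L:W\to\mathbb{Z}$ satisfies $L(xy)=L(x)+L(y)$ whenever $\ell(xy)=\ell(x)+\ell(y)$; positive means positive on all of $S$. $\mathcal{A}=\mathbb{Z}[v,v^{-1}]$, $v_x=v^{L(x)}$. $\mathcal{H}$ is the $\mathcal{A}$-algebra with basis $\{T_x\}_{x\in W}$ and, for $s\in S$, $T_sT_x=T_{sx}$ if $\ell(sx)>\ell(x)$, $T_sT_x=T_{sx}+(v_s-v_s^{-1})T_x$ if $\ell(sx)<\ell(x)$. The bar involution is the ring involution $v\mapsto v^{-1}$, $T_x\mapsto T_{x^{-1}}^{-1}$. The Kazhdan-Lusztig basis $\{C_x\}$ consists of the unique bar-invariant elements $C_y=\sum_x p_{xy}T_x$ with $p_{yy}=1$ and $p_{xy}\in v^{-1}\mathbb{Z}[v^{-1}]$ for $x\ne y$. Write $C_xC_y=\sum_z h_{xyz}C_z$. Let $\leq_{\mathcal{L}}$ be the preorder generated by: $y\leq_{\mathcal{L}}x$ if $C_y$ has nonzero coefficient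 in $C_sC_x$ for some $s\in S$; $y\leq_{\mathcal{R}}x$ iff $y^{-1}\leq_{\mathcal{L}}x^{-1}$; $\leq_{\mathcal{LR}}$ is generated by both. The associated equivalence relations are $\sim_{\mathcal{L}},\sim_{\mathcal{R}},\sim_{\mathcal{LR}}$, and their classes are left, right, two-sided Kazhdan-Lusztig cells. **Left cell modules.** For a left cell $\mathfrak{C}$ and $x\in\mathfrak{C}$, $[\mathfrak{C}]_{\mathcal{A}}=\bigoplus_{y\leq_{\mathcal{L}}x}\mathcal{A}C_y\big/\bigoplus_{y\leq_{\mathcal{L}}x,\,y\notin\mathfrak{C}}\mathcal{A}C_y$, a left $\mathcal{H}$-module with $\mathcal{A}$-basis $\{e_x\mid x\in\mathfrak{C}\}$ (images of the $C_x$) and action $C_xe_y=\sum_{z\in\mathfrak{C}}h_{xyz}e_z$. $[\mathfrak{C}]$ is the $\mathbb{C}[W]$-module obtained by specializing $v\mapsto1$ and extending scalars to $\mathbb{C}$ (so $T_w\mapsto w$). **P1-P15.** For $z\in W$ let $\boldsymbol{a}(z)$ be the smallest non-negative integer with $h_{xyz}\in v^{\boldsymbol{a}(z)}\mathbb{Z}[v^{-1}]$ for all $x,y$; let $\gamma_{x,y,z^{-1}}$ be the constant term of $v^{-\boldsymbol{a}(z)}h_{xyz}$. Write $p_{1z}=n_zv^{-\Delta(z)}+$ terms of smaller degree in $v$, $n_z\neq0$. $\mathcal{D}=\{z\mid\boldsymbol{a}(z)=\Delta(z)\}$. P1: $\boldsymbol{a}(z)\le\Delta(z)$. P2: if $d\in\mathcal{D}$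 and $\gamma_{x,y,d}\ne0$ then $x=y^{-1}$. P3: for each $y$ there is a unique $d\in\mathcal{D}$ with $\gamma_{y^{-1},y,d}\neq0$. P4: $z'\leq_{\mathcal{LR}}z$ implies $\boldsymbol{a}(z')\geq\boldsymbol{a}(z)$. P5: if $d\in\mathcal{D}$ and $\gamma_{y^{-1},y,d}\neq0$ then $\gamma_{y^{-1},y,d}=n_d=\pm1$. P6: $d\in\mathcal{D}$ implies $d^2=1$. P7: $\gamma_{x,y,z}=\gamma_{y,z,x}$. P8: $\gamma_{x,y,z}\neq0$ implies $x\sim_{\mathcal{L}}y^{-1}$, $y\sim_{\mathcal{L}}z^{-1}$, $z\sim_{\mathcal{L}}x^{-1}$. P9 (resp. P10, P11): if $z'\leq z$ and $\boldsymbol{a}(z')=\boldsymbol{a}(z)$ then $z'\sim z$, for $\leq_{\mathcal{L}}$ (resp. $\leq_{\mathcal{R}}$, $\leq_{\mathcal{LR}}$). P12: for $I\subseteq S$ and $y\in W_I$, $\boldsymbol{a}(y)$ computed in $W_I$ equals $\boldsymbol{a}(y)$ computed in $W$. P13: each left cell $\mathfrak{C}$ contains a unique $d\in\mathcal{D}$, and $\gamma_{x^{-1},x,d}\ne0$ for all $x\in\mathfrak{C}$. P14: $z\sim_{\mathcal{LR}}z^{-1}$. P15: with $v'$ another indeterminate and $h'_{xyz}$ obtained from $h_{xyz}$ by $v\mapsto v'$, if $\boldsymbol{a}(w)=\boldsymbol{a}(y)$ then $\sum_{y'}h'_{wx'y'}h_{xy'y}=\sum_{y'}h_{xwy'}h'_{y'x'y}$.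 *)

theory Defs
  imports
    Complex_Main
    "HOL-Library.Poly_Mapping"
    "HOL-Library.Function_Algebras"
    "HOL-Algebra.Multiplicative_Group"
    "HOL-Algebra.Generated_Groups"
begin

section \<open>Coxeter systems and weight functions\<close>

definition word_prod :: "('w, 'm) monoid_scheme \<Rightarrow> 'w list \<Rightarrow> 'w" where
  "word_prod G ws = foldr (mult G) ws \<one>\<^bsub>G\<^esub>"

text \<open>One insertion of a relator \<open>(st)\<^sup>m\<close>, where \<open>m\<close> is the finite order of \<open>st\<close>. The
  case \<open>s = t\<close> gives \<open>m = 1\<close>, i.e. the relator \<open>ss\<close>; so words in \<open>S\<close> modulo the
  equivalence generated by these steps form the group with presentation
  \<open>\<langle>S | (st)\<^sup>m = 1\<rangle>\<close>, inverses of generators being redundant.\<close>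

definition relator_step :: "('w, 'm) monoid_scheme \<Rightarrow> 'w set \<Rightarrow> 'w list \<Rightarrow> 'w list \<Rightarrow> bool" where
  "relator_step G S u w \<longleftrightarrow> (\<exists>a\<in>lists S. \<exists>b\<in>lists S. \<exists>s\<in>S. \<exists>t\<in>S.
     group.ord G (s \<otimes>\<^bsub>G\<^esub> t) > 0 \<and>
     u = a @ b \<and>
     w = a @ concat (replicate (group.ord G (s \<otimes>\<^bsub>G\<^esub> t)) [s, t]) @ b)"

locale coxeter_system = group G for G (structure) +
  fixes S
  assumes S_subset: "S \<subseteq> carrier G"
    and S_involutions: "s \<in> S \<Longrightarrow> ord s = 2"
    and S_generates: "generate G S = carrier G"
    and presentation: "\<lbrakk>u \<in> lists S; w \<in> lists S\<rbrakk> \<Longrightarrow>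
           word_prod G u = word_prod G w \<longleftrightarrow> equivclp (relator_step G S) u w"

definition cox_length :: "('w, 'm) monoid_scheme \<Rightarrow> 'w set \<Rightarrow> 'w \<Rightarrow> nat" where
  "cox_length G S x = (LEAST n. \<exists>ws\<in>lists S. length ws = n \<and> word_prod G ws = x)"

definition weight_function :: "('w, 'm) monoid_scheme \<Rightarrow> 'w set \<Rightarrow> ('w \<Rightarrow> int) \<Rightarrow> bool" where
  "weight_function G S L \<longleftrightarrow> (\<forall>x\<in>carrier G. \<forall>y\<in>carrier G.
     cox_length G S (x \<otimes>\<^bsub>G\<^esub> y) = cox_length G S x + cox_length G S y \<longrightarrow>
     L (x \<otimes>\<^bsub>G\<^esub> y) = L x + L y)"

definition positive_weight_function :: "('w, 'm) monoid_scheme \<Rightarrow> 'w set \<Rightarrow> ('w \<Rightarrow> int) \<Rightarrow> bool" where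
  "positive_weight_function G S L \<longleftrightarrow> weight_function G S L \<and> (\<forall>s\<in>S. L s > 0)"


section \<open>Laurent polynomials and free modules\<close>

text \<open>\<open>\<int>[v, v\<^sup>-\<^sup>1]\<close> is the group ring of the additive group \<open>\<int>\<close>: \<open>Poly_Mapping.lookup p k\<close> is
  the coefficient of \<open>v\<^sup>k\<close>.\<close>

type_synonym laurent = "int \<Rightarrow>\<^sub>0 int"

definition vpow :: "int \<Rightarrow> laurent" where
  "vpow k = Poly_Mapping.single k 1"

definition laurent_bar :: "laurent \<Rightarrow> laurent" where
  "laurent_bar p = Poly_Mapping.map_key uminus p"

definition at_v_1 :: "laurent \<Rightarrow> complex" where
  "at_v_1 p = of_int (\<Sum>k\<in>Poly_Mapping.keys p. Poly_Mapping.lookup p k)"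

text \<open>The free module on a set \<open>B\<close>, with basis \<open>Poly_Mapping.single b 1\<close> for \<open>b \<in> B\<close>.\<close>

definition free_mod :: "'w set \<Rightarrow> ('w \<Rightarrow>\<^sub>0 'r::zero) set" where
  "free_mod B = {f. Poly_Mapping.keys f \<subseteq> B}"

definition scale :: "'r::semiring_0 \<Rightarrow> ('w \<Rightarrow>\<^sub>0 'r) \<Rightarrow> ('w \<Rightarrow>\<^sub>0 'r)" where
  "scale c f = Poly_Mapping.map ((*) c) f"


section \<open>The Hecke algebra\<close>

abbreviation T :: "'w \<Rightarrow> ('w \<Rightarrow>\<^sub>0 laurent)" where
  "T x \<equiv> Poly_Mapping.single x 1"

text \<open>\<open>H\<close> is the algebra structure on the free \<open>\<int>[v, v\<^sup>-\<^sup>1]\<close>-module with basis \<open>T x\<close>,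
  \<open>x \<in> W\<close>, for which \<open>T \<one>\<close> is the identity and the multiplication rules for \<open>T s \<cdot> T x\<close> hold.
  These conditions determine the multiplication of \<open>H\<close> on its carrier.\<close>

locale hecke_algebra = coxeter_system G S + H: ring H
  for G :: "('w, 'm) monoid_scheme" (structure)
    and S :: "'w set"
    and L :: "'w \<Rightarrow> int"
    and H :: "('w \<Rightarrow>\<^sub>0 laurent, 'n) ring_scheme" +
  assumes carrier_H: "carrier H = free_mod (carrier G)"
    and zero_H: "\<zero>\<^bsub>H\<^esub> = 0"
    and add_H: "\<lbrakk>f \<in> carrier H; g \<in> carrier H\<rbrakk> \<Longrightarrow> f \<oplus>\<^bsub>H\<^esub> g = f + g"
    and one_H: "\<one>\<^bsub>H\<^esub> = T \<one>"
    and scale_mult_H: "\<lbrakk>f \<in> carrier H; g \<in> carrier H\<rbrakk> \<Longrightarrow> scale c f \<otimes>\<^bsub>H\<^esub> g = scale c (f \<otimes>\<^bsub>H\<^esub> g)"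
    and mult_scale_H: "\<lbrakk>f \<in> carrier H; g \<in> carrier H\<rbrakk> \<Longrightarrow> f \<otimes>\<^bsub>H\<^esub> scale c g = scale c (f \<otimes>\<^bsub>H\<^esub> g)"
    and T_mult_up: "\<lbrakk>s \<in> S; x \<in> carrier G; cox_length G S (s \<otimes> x) > cox_length G S x\<rbrakk> \<Longrightarrow>
           T s \<otimes>\<^bsub>H\<^esub> T x = T (s \<otimes> x)"
    and T_mult_down: "\<lbrakk>s \<in> S; x \<in> carrier G; cox_length G S (s \<otimes> x) < cox_length G S x\<rbrakk> \<Longrightarrow>
           T s \<otimes>\<^bsub>H\<^esub> T x = T (s \<otimes> x) + scale (vpow (L s) - vpow (- L s)) (T x)"

text \<open>In the following definitions \<open>G\<close> is the Coxeter group and \<open>H\<close> its Hecke algebra; the weight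
  function enters only through the multiplication of \<open>H\<close>.\<close>

definition hecke_bar ::
  "('w, 'm) monoid_scheme \<Rightarrow> ('w \<Rightarrow>\<^sub>0 laurent, 'n) ring_scheme \<Rightarrow> ('w \<Rightarrow>\<^sub>0 laurent) \<Rightarrow> ('w \<Rightarrow>\<^sub>0 laurent)"
where
  "hecke_bar G H f = (\<Sum>x\<in>Poly_Mapping.keys f.
     scale (laurent_bar (Poly_Mapping.lookup f x)) (inv\<^bsub>H\<^esub> (T (inv\<^bsub>G\<^esub> x))))"

definition kl_basis ::
  "('w, 'm) monoid_scheme \<Rightarrow> ('w \<Rightarrow>\<^sub>0 laurent, 'n) ring_scheme \<Rightarrow> 'w \<Rightarrow> ('w \<Rightarrow>\<^sub>0 laurent)"
where
  "kl_basis G H y = (THE c. c \<in> carrier H \<and> hecke_bar G H c = c \<and>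
     Poly_Mapping.lookup c y = 1 \<and>
     (\<forall>x\<in>carrier G. x \<noteq> y \<longrightarrow> (\<forall>k\<in>Poly_Mapping.keys (Poly_Mapping.lookup c x). k < 0)))"

definition kl_poly ::
  "('w, 'm) monoid_scheme \<Rightarrow> ('w \<Rightarrow>\<^sub>0 laurent, 'n) ring_scheme \<Rightarrow> 'w \<Rightarrow> 'w \<Rightarrow> laurent"
where
  "kl_poly G H x y = Poly_Mapping.lookup (kl_basis G H y) x"

text \<open>The coordinates of an element of \<open>H\<close> in the Kazhdan--Lusztig basis.\<close>

definition kl_coords ::
  "('w, 'm) monoid_scheme \<Rightarrow> ('w \<Rightarrow>\<^sub>0 laurent, 'n) ring_scheme \<Rightarrow> ('w \<Rightarrow>\<^sub>0 laurent) \<Rightarrow> ('w \<Rightarrow>\<^sub>0 laurent)"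
where
  "kl_coords G H f = (THE c. c \<in> free_mod (carrier G) \<and>
     f = (\<Sum>z\<in>Poly_Mapping.keys c. scale (Poly_Mapping.lookup c z) (kl_basis G H z)))"

definition kl_h ::
  "('w, 'm) monoid_scheme \<Rightarrow> ('w \<Rightarrow>\<^sub>0 laurent, 'n) ring_scheme \<Rightarrow> 'w \<Rightarrow> 'w \<Rightarrow> 'w \<Rightarrow> laurent"
where
  "kl_h G H x y z =
     Poly_Mapping.lookup (kl_coords G H (kl_basis G H x \<otimes>\<^bsub>H\<^esub> kl_basis G H y)) z"


section \<open>Kazhdan--Lusztig cells\<close>

text \<open>\<open>le_L G S H y x\<close> stands for \<open>y \<le>\<^sub>L x\<close>, and similarly for the other preorders.\<close>

definition le_L ::
  "('w, 'm) monoid_scheme \<Rightarrow> 'w set \<Rightarrow> ('w \<Rightarrow>\<^sub>0 laurent, 'n) ring_scheme \<Rightarrow> 'w \<Rightarrow> 'w \<Rightarrow> bool"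
where
  "le_L G S H = (\<lambda>y x. x \<in> carrier G \<and> y \<in> carrier G \<and> (\<exists>s\<in>S. kl_h G H s x y \<noteq> 0))\<^sup>*\<^sup>*"

definition le_R ::
  "('w, 'm) monoid_scheme \<Rightarrow> 'w set \<Rightarrow> ('w \<Rightarrow>\<^sub>0 laurent, 'n) ring_scheme \<Rightarrow> 'w \<Rightarrow> 'w \<Rightarrow> bool"
where
  "le_R G S H y x \<longleftrightarrow> le_L G S H (inv\<^bsub>G\<^esub> y) (inv\<^bsub>G\<^esub> x)"

definition le_LR ::
  "('w, 'm) monoid_scheme \<Rightarrow> 'w set \<Rightarrow> ('w \<Rightarrow>\<^sub>0 laurent, 'n) ring_scheme \<Rightarrow> 'w \<Rightarrow> 'w \<Rightarrow> bool"
where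
  "le_LR G S H =
     (\<lambda>y x. x \<in> carrier G \<and> y \<in> carrier G \<and> (le_L G S H y x \<or> le_R G S H y x))\<^sup>*\<^sup>*"

definition sim_L ::
  "('w, 'm) monoid_scheme \<Rightarrow> 'w set \<Rightarrow> ('w \<Rightarrow>\<^sub>0 laurent, 'n) ring_scheme \<Rightarrow> 'w \<Rightarrow> 'w \<Rightarrow> bool"
where
  "sim_L G S H x y \<longleftrightarrow> le_L G S H x y \<and> le_L G S H y x"

definition sim_R ::
  "('w, 'm) monoid_scheme \<Rightarrow> 'w set \<Rightarrow> ('w \<Rightarrow>\<^sub>0 laurent, 'n) ring_scheme \<Rightarrow> 'w \<Rightarrow> 'w \<Rightarrow> bool"
where
  "sim_R G S H x y \<longleftrightarrow> le_R G S H x y \<and> le_R G S H y x"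

definition sim_LR ::
  "('w, 'm) monoid_scheme \<Rightarrow> 'w set \<Rightarrow> ('w \<Rightarrow>\<^sub>0 laurent, 'n) ring_scheme \<Rightarrow> 'w \<Rightarrow> 'w \<Rightarrow> bool"
where
  "sim_LR G S H x y \<longleftrightarrow> le_LR G S H x y \<and> le_LR G S H y x"

definition left_cells ::
  "('w, 'm) monoid_scheme \<Rightarrow> 'w set \<Rightarrow> ('w \<Rightarrow>\<^sub>0 laurent, 'n) ring_scheme \<Rightarrow> 'w set set"
where
  "left_cells G S H =
     carrier G // {(x, y). x \<in> carrier G \<and> y \<in> carrier G \<and> sim_L G S H x y}"


section \<open>Lusztig's conjectural properties\<close>

definition a_fun ::
  "('w, 'm) monoid_scheme \<Rightarrow> ('w \<Rightarrow>\<^sub>0 laurent, 'n) ring_scheme \<Rightarrow> 'w \<Rightarrow> nat"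
where
  "a_fun G H z = (LEAST n. \<forall>x\<in>carrier G. \<forall>y\<in>carrier G.
     \<forall>k\<in>Poly_Mapping.keys (kl_h G H x y z). k \<le> int n)"

text \<open>Indexed as \<open>\<gamma>\<^sub>x\<^sub>,\<^sub>y\<^sub>,\<^sub>u\<close>, which is read off from \<open>h\<^sub>x\<^sub>y\<^sub>z\<close> with \<open>z = u\<^sup>-\<^sup>1\<close>.\<close>

definition gam ::
  "('w, 'm) monoid_scheme \<Rightarrow> ('w \<Rightarrow>\<^sub>0 laurent, 'n) ring_scheme \<Rightarrow> 'w \<Rightarrow> 'w \<Rightarrow> 'w \<Rightarrow> int"
where
  "gam G H x y u =
     Poly_Mapping.lookup (vpow (- int (a_fun G H (inv\<^bsub>G\<^esub> u))) * kl_h G H x y (inv\<^bsub>G\<^esub> u)) 0"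

definition Delta ::
  "('w, 'm) monoid_scheme \<Rightarrow> ('w \<Rightarrow>\<^sub>0 laurent, 'n) ring_scheme \<Rightarrow> 'w \<Rightarrow> int"
where
  "Delta G H z = - Max (Poly_Mapping.keys (kl_poly G H \<one>\<^bsub>G\<^esub> z))"

definition n_coeff ::
  "('w, 'm) monoid_scheme \<Rightarrow> ('w \<Rightarrow>\<^sub>0 laurent, 'n) ring_scheme \<Rightarrow> 'w \<Rightarrow> int"
where
  "n_coeff G H z = Poly_Mapping.lookup (kl_poly G H \<one>\<^bsub>G\<^esub> z) (- Delta G H z)"

definition dist_set ::
  "('w, 'm) monoid_scheme \<Rightarrow> ('w \<Rightarrow>\<^sub>0 laurent, 'n) ring_scheme \<Rightarrow> 'w set"
where
  "dist_set G H = {z \<in> carrier G. int (a_fun G H z) = Delta G H z}"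

text \<open>The Hecke algebra of \<open>(W\<^sub>I, I, L|W\<^sub>I)\<close>: the subalgebra of \<open>H\<close> spanned by \<open>T w\<close>, \<open>w \<in> W\<^sub>I\<close>.\<close>

definition parabolic_hecke ::
  "('w, 'm) monoid_scheme \<Rightarrow> 'w set \<Rightarrow> ('w \<Rightarrow>\<^sub>0 laurent, 'n) ring_scheme \<Rightarrow> ('w \<Rightarrow>\<^sub>0 laurent, 'n) ring_scheme"
where
  "parabolic_hecke G I H = H\<lparr>carrier := free_mod (carrier (subgroup_generated G I))\<rparr>"

text \<open>\<open>\<int>[v, v\<^sup>-\<^sup>1][v', v'\<^sup>-\<^sup>1]\<close> as Laurent polynomials in \<open>v'\<close> (outer exponent) with coefficients in
  \<open>\<int>[v, v\<^sup>-\<^sup>1]\<close>, and the two embeddings \<open>v \<mapsto> v\<close> and \<open>v \<mapsto> v'\<close> of \<open>\<int>[v, v\<^sup>-\<^sup>1]\<close>.\<close>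

definition in_v :: "laurent \<Rightarrow> (int \<Rightarrow>\<^sub>0 laurent)" where
  "in_v p = Poly_Mapping.single 0 p"

definition in_v' :: "laurent \<Rightarrow> (int \<Rightarrow>\<^sub>0 laurent)" where
  "in_v' p = Poly_Mapping.map (Poly_Mapping.single 0) p"

context
  fixes G :: "('w, 'm) monoid_scheme" (structure)
    and S :: "'w set"
    and H :: "('w \<Rightarrow>\<^sub>0 laurent, 'n) ring_scheme"
begin

definition P1 :: bool where
  "P1 \<longleftrightarrow> (\<forall>z\<in>carrier G. int (a_fun G H z) \<le> Delta G H z)"

definition P2 :: bool where
  "P2 \<longleftrightarrow> (\<forall>d\<in>dist_set G H. \<forall>x\<in>carrier G. \<forall>y\<in>carrier G.
     gam G H x y d \<noteq> 0 \<longrightarrow> x = inv y)"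

definition P3 :: bool where
  "P3 \<longleftrightarrow> (\<forall>y\<in>carrier G. \<exists>!d. d \<in> dist_set G H \<and> gam G H (inv y) y d \<noteq> 0)"

definition P4 :: bool where
  "P4 \<longleftrightarrow> (\<forall>z'\<in>carrier G. \<forall>z\<in>carrier G. le_LR G S H z' z \<longrightarrow> a_fun G H z' \<ge> a_fun G H z)"

definition P5 :: bool where
  "P5 \<longleftrightarrow> (\<forall>d\<in>dist_set G H. \<forall>y\<in>carrier G. gam G H (inv y) y d \<noteq> 0 \<longrightarrow>
     gam G H (inv y) y d = n_coeff G H d \<and> (n_coeff G H d = 1 \<or> n_coeff G H d = -1))"

definition P6 :: bool where
  "P6 \<longleftrightarrow> (\<forall>d\<in>dist_set G H. d \<otimes> d = \<one>)"

definition P7 :: bool where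
  "P7 \<longleftrightarrow> (\<forall>x\<in>carrier G. \<forall>y\<in>carrier G. \<forall>z\<in>carrier G. gam G H x y z = gam G H y z x)"

definition P8 :: bool where
  "P8 \<longleftrightarrow> (\<forall>x\<in>carrier G. \<forall>y\<in>carrier G. \<forall>z\<in>carrier G. gam G H x y z \<noteq> 0 \<longrightarrow>
     sim_L G S H x (inv y) \<and> sim_L G S H y (inv z) \<and> sim_L G S H z (inv x))"

definition P9 :: bool where
  "P9 \<longleftrightarrow> (\<forall>z'\<in>carrier G. \<forall>z\<in>carrier G.
     le_L G S H z' z \<and> a_fun G H z' = a_fun G H z \<longrightarrow> sim_L G S H z' z)"

definition P10 :: bool where
  "P10 \<longleftrightarrow> (\<forall>z'\<in>carrier G. \<forall>z\<in>carrier G.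
     le_R G S H z' z \<and> a_fun G H z' = a_fun G H z \<longrightarrow> sim_R G S H z' z)"

definition P11 :: bool where
  "P11 \<longleftrightarrow> (\<forall>z'\<in>carrier G. \<forall>z\<in>carrier G.
     le_LR G S H z' z \<and> a_fun G H z' = a_fun G H z \<longrightarrow> sim_LR G S H z' z)"

definition P12 :: bool where
  "P12 \<longleftrightarrow> (\<forall>I\<subseteq>S. \<forall>y\<in>carrier (subgroup_generated G I).
     a_fun (subgroup_generated G I) (parabolic_hecke G I H) y = a_fun G H y)"

definition P13 :: bool where
  "P13 \<longleftrightarrow> (\<forall>CC\<in>left_cells G S H. \<exists>d. CC \<inter> dist_set G H = {d} \<and>
     (\<forall>x\<in>CC. gam G H (inv x) x d \<noteq> 0))"

definition P14 :: bool where
  "P14 \<longleftrightarrow> (\<forall>z\<in>carrier G. sim_LR G S H z (inv z))"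

definition P15 :: bool where
  "P15 \<longleftrightarrow> (\<forall>w\<in>carrier G. \<forall>x\<in>carrier G. \<forall>x'\<in>carrier G. \<forall>y\<in>carrier G.
     a_fun G H w = a_fun G H y \<longrightarrow>
     (\<Sum>y'\<in>carrier G. in_v' (kl_h G H w x' y') * in_v (kl_h G H x y' y)) =
     (\<Sum>y'\<in>carrier G. in_v (kl_h G H x w y') * in_v' (kl_h G H y' x' y)))"

definition P1_to_P15 :: bool where
  "P1_to_P15 \<longleftrightarrow> P1 \<and> P2 \<and> P3 \<and> P4 \<and> P5 \<and> P6 \<and> P7 \<and> P8 \<and> P9 \<and> P10 \<and> P11 \<and> P12 \<and>
     P13 \<and> P14 \<and> P15"

end


section \<open>Left cell modules\<close>

text \<open>The module \<open>[CC]\<^sub>A\<close> has basis \<open>e\<^sub>y = Poly_Mapping.single y 1\<close> for \<open>y \<in> CC\<close>, the class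
  of the Kazhdan--Lusztig basis element of \<open>y\<close> in the quotient of the span of all
  \<open>z \<le>\<^sub>L y\<close> by the span of those outside \<open>CC\<close>. Hence \<open>f\<close> in the Hecke algebra sends \<open>e\<^sub>y\<close> to the
  \<open>CC\<close>-part of \<open>f \<cdot> C\<^sub>y\<close>; for \<open>f = C\<^sub>x\<close> the matrix entries are \<open>h\<^sub>x\<^sub>y\<^sub>z\<close>.\<close>

definition cell_act_A ::
  "('w, 'm) monoid_scheme \<Rightarrow> ('w \<Rightarrow>\<^sub>0 laurent, 'n) ring_scheme \<Rightarrow> 'w set \<Rightarrow>
   ('w \<Rightarrow>\<^sub>0 laurent) \<Rightarrow> ('w \<Rightarrow>\<^sub>0 laurent) \<Rightarrow> ('w \<Rightarrow>\<^sub>0 laurent)"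
where
  "cell_act_A G H CC f m = (\<Sum>y\<in>Poly_Mapping.keys m. scale (Poly_Mapping.lookup m y)
     (\<Sum>z\<in>CC. Poly_Mapping.single z
        (Poly_Mapping.lookup (kl_coords G H (f \<otimes>\<^bsub>H\<^esub> kl_basis G H y)) z)))"

text \<open>\<open>[CC]\<close> is the complex vector space \<open>free_mod CC\<close> on which \<open>w \<in> W\<close> acts by the specialization at
  \<open>v = 1\<close> of the matrix of \<open>T w\<close> on \<open>[CC]\<^sub>A\<close>.\<close>

definition cell_act ::
  "('w, 'm) monoid_scheme \<Rightarrow> ('w \<Rightarrow>\<^sub>0 laurent, 'n) ring_scheme \<Rightarrow> 'w set \<Rightarrow>
   'w \<Rightarrow> ('w \<Rightarrow>\<^sub>0 complex) \<Rightarrow> ('w \<Rightarrow>\<^sub>0 complex)"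
where
  "cell_act G H CC w m = (\<Sum>y\<in>Poly_Mapping.keys m. scale (Poly_Mapping.lookup m y)
     (\<Sum>z\<in>CC. Poly_Mapping.single z
        (at_v_1 (Poly_Mapping.lookup (cell_act_A G H CC (T w) (Poly_Mapping.single y 1)) z))))"

text \<open>A homomorphism \<open>[CC] \<rightarrow> [CC']\<close> is represented by the function that extends it by zero outside
  \<open>free_mod CC\<close>.\<close>

definition Hom_W ::
  "('w, 'm) monoid_scheme \<Rightarrow> ('w \<Rightarrow>\<^sub>0 laurent, 'n) ring_scheme \<Rightarrow> 'w set \<Rightarrow> 'w set \<Rightarrow>
   (('w \<Rightarrow>\<^sub>0 complex) \<Rightarrow> ('w \<Rightarrow>\<^sub>0 complex)) set"
where
  "Hom_W G H CC CC' = {\<phi>.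
     (\<forall>m\<in>free_mod CC. \<phi> m \<in> free_mod CC') \<and>
     (\<forall>m. m \<notin> free_mod CC \<longrightarrow> \<phi> m = 0) \<and>
     (\<forall>m\<in>free_mod CC. \<forall>m'\<in>free_mod CC. \<phi> (m + m') = \<phi> m + \<phi> m') \<and>
     (\<forall>c. \<forall>m\<in>free_mod CC. \<phi> (scale c m) = scale c (\<phi> m)) \<and>
     (\<forall>w\<in>carrier G. \<forall>m\<in>free_mod CC. \<phi> (cell_act G H CC w m) = cell_act G H CC' w (\<phi> m))}"

definition hom_scale ::
  "complex \<Rightarrow> (('w \<Rightarrow>\<^sub>0 complex) \<Rightarrow> ('w \<Rightarrow>\<^sub>0 complex)) \<Rightarrow> (('w \<Rightarrow>\<^sub>0 complex) \<Rightarrow> ('w \<Rightarrow>\<^sub>0 complex))"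
where
  "hom_scale c \<phi> = (\<lambda>m. scale c (\<phi> m))"

lemma lookup_scale: "Poly_Mapping.lookup (scale c f) x = c * Poly_Mapping.lookup f x"
  unfolding scale_def by (simp add: Poly_Mapping.map.rep_eq when_def)

interpretation hom_space: vector_space hom_scale
  by unfold_locales
    (auto simp: hom_scale_def fun_eq_iff poly_mapping_eq_iff lookup_scale
       Poly_Mapping.lookup_add algebra_simps)

definition dim_Hom_W ::
  "('w, 'm) monoid_scheme \<Rightarrow> ('w \<Rightarrow>\<^sub>0 laurent, 'n) ring_scheme \<Rightarrow> 'w set \<Rightarrow> 'w set \<Rightarrow> nat"
where
  "dim_Hom_W G H CC CC' = vector_space.dim hom_scale (Hom_W G H CC CC')"

end

(* Specialize the Kazhdan-Lusztig basis at v = 1. The direct sum of all left cell modules is the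
   associated graded module of the regular representation, and on its basis one also has the
   multiplication of Lusztig's asymptotic ring J, with structure constants gamma. The top
   coefficients of P15 say that W commutes with right multiplication by J. Traces show that the
   group algebra acts faithfully, so h |-> h 1_J is injective, hence bijective for dimension
   reasons: every left multiplication by an element of J comes from the group algebra. A
   W-endomorphism psi of the direct sum is therefore right multiplication by psi(1_J), and the
   homomorphisms between the modules of two left cells CC and CC' have as a basis the right
   multiplications by t_x with x in CC' and x^-1 in CC; their independence is seen on the
   distinguished element of CC. *)

theory Submission
  imports Defs
begin

text \<open>The passage to the associated graded module is forced: P15 only speaks about a(w) =
  a(y), and truncating the W-action to left cells is what removes the terms where the a-function
  jumps (P4, P9). The truncation leaves diagonal entries alone, so the trace is still that of the
  regular representation. The ring J enters through the matrices \<open>rmult x\<close> of right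
  multiplication and the vector \<open>unit_J\<close>, tied together by 1_J t_x = t_x. Behind their
  use is h t_x = h (1_J t_x) = (h 1_J) t_x: if h 1_J = 0, then h acts by zero, and if h 1_J = t_y,
  then h acts as left multiplication by t_y. A second task comes from the definitions: H is given by
  left multiplication rules for the T_s, and the Kazhdan-Lusztig basis, its coordinates and the
  a-function are definite descriptions or least numbers. The bar involution and the existence,
  uniqueness and basis property of the C_y are therefore derived first, by inductions along the
  length filtration \<open>below\<close>.\<close>

abbreviation coeff :: "('a \<Rightarrow>\<^sub>0 'b::zero) \<Rightarrow> 'a \<Rightarrow> 'b" where
  "coeff \<equiv> Poly_Mapping.lookup"

section \<open>Laurent polynomials\<close>

lemma poly_mapping_sum_single:
  "p = (\<Sum>k\<in>Poly_Mapping.keys p. Poly_Mapping.single k (coeff p k))"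
proof (rule poly_mapping_eqI)
  fix k
  show "coeff p k = coeff (\<Sum>k\<in>Poly_Mapping.keys p. Poly_Mapping.single k (coeff p k)) k"
    by (simp add: Poly_Mapping.lookup_sum Poly_Mapping.lookup_single when_def sum.delta in_keys_iff)
qed

lemma coeff_single_mult:
  fixes p :: "'a::ab_group_add \<Rightarrow>\<^sub>0 'b::semiring_0"
  shows "coeff (Poly_Mapping.single k c * p) m = c * coeff p (m - k)"
proof -
  have "(\<Sum>q. coeff p q when m = k + q) = coeff p (m - k)"
  proof -
    have "(m = k + q) = (q = m - k)" for q by (auto simp: algebra_simps)
    then show ?thesis by simp
  qed
  moreover have "coeff (Poly_Mapping.single k c * p) m
      = (\<Sum>l. (c * (\<Sum>q. coeff p q when m = l + q)) when l = k)"
    unfolding Poly_Mapping.lookup_mult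
    by (rule Sum_any.cong) (simp add: Poly_Mapping.lookup_single when_def)
  ultimately show ?thesis by simp
qed

lemma coeff_laurent_bar: "coeff (laurent_bar p) k = coeff p (- k)"
  unfolding laurent_bar_def by (simp add: Poly_Mapping.map_key.rep_eq)

lemma laurent_bar_add: "laurent_bar (p + q) = laurent_bar p + laurent_bar q"
  by (rule poly_mapping_eqI) (simp add: coeff_laurent_bar Poly_Mapping.lookup_add)

lemma laurent_bar_0 [simp]: "laurent_bar 0 = 0"
  by (rule poly_mapping_eqI) (simp add: coeff_laurent_bar)

lemma laurent_bar_diff: "laurent_bar (p - q) = laurent_bar p - laurent_bar q"
  by (rule poly_mapping_eqI) (simp add: coeff_laurent_bar Poly_Mapping.lookup_minus)

lemma laurent_bar_sum: "laurent_bar (sum f A) = (\<Sum>x\<in>A. laurent_bar (f x))"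
  by (rule poly_mapping_eqI) (simp add: coeff_laurent_bar Poly_Mapping.lookup_sum)

lemma laurent_bar_bar [simp]: "laurent_bar (laurent_bar p) = p"
  by (rule poly_mapping_eqI) (simp add: coeff_laurent_bar)

lemma laurent_bar_vpow [simp]: "laurent_bar (vpow k) = vpow (- k)"
  by (rule poly_mapping_eqI)
    (auto simp: coeff_laurent_bar vpow_def Poly_Mapping.lookup_single when_def)

lemma vpow_0 [simp]: "vpow 0 = 1"
  by (simp add: vpow_def)

lemma laurent_bar_1 [simp]: "laurent_bar 1 = 1"
  using laurent_bar_vpow[of 0] by simp

lemma laurent_bar_mult: "laurent_bar (p * q) = laurent_bar p * laurent_bar q"
proof -
  have single: "laurent_bar (Poly_Mapping.single k c * q) = Poly_Mapping.single (- k) c * laurent_bar q"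
    for k c q
    by (rule poly_mapping_eqI) (simp add: coeff_laurent_bar coeff_single_mult)
  have single': "laurent_bar (Poly_Mapping.single k c) = Poly_Mapping.single (- k) c" for k c
    by (rule poly_mapping_eqI)
      (auto simp: coeff_laurent_bar Poly_Mapping.lookup_single when_def)
  have "laurent_bar ((\<Sum>k\<in>K. Poly_Mapping.single k (coeff p k)) * q)
    = laurent_bar (\<Sum>k\<in>K. Poly_Mapping.single k (coeff p k)) * laurent_bar q" for K
    by (simp add: sum_distrib_right laurent_bar_sum single single')
  from this[of "Poly_Mapping.keys p"] show ?thesis
    by (simp add: poly_mapping_sum_single[symmetric])
qed

lemma at_v_1_eq_sum:
  assumes "finite A" "Poly_Mapping.keys p \<subseteq> A"
  shows "at_v_1 p = of_int (\<Sum>k\<in>A. coeff p k)"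
  unfolding at_v_1_def
  by (rule arg_cong[where f=of_int], rule sum.mono_neutral_left)
    (use assms in \<open>auto simp: in_keys_iff\<close>)

lemma at_v_1_0 [simp]: "at_v_1 0 = 0"
  by (simp add: at_v_1_def)

lemma at_v_1_single [simp]: "at_v_1 (Poly_Mapping.single k c) = of_int c"
  by (subst at_v_1_eq_sum[of "{k}"]) auto

lemma at_v_1_vpow [simp]: "at_v_1 (vpow k) = 1"
  by (simp add: vpow_def)

lemma at_v_1_1 [simp]: "at_v_1 1 = 1"
  using at_v_1_vpow[of 0] by simp

lemma at_v_1_add: "at_v_1 (p + q) = at_v_1 p + at_v_1 q"
proof -
  let ?A = "Poly_Mapping.keys p \<union> Poly_Mapping.keys q"
  have "at_v_1 (p + q) = of_int (\<Sum>k\<in>?A. coeff (p + q) k)"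
    by (rule at_v_1_eq_sum) (use Poly_Mapping.keys_add[of p q] in auto)
  moreover have "at_v_1 p = of_int (\<Sum>k\<in>?A. coeff p k)" "at_v_1 q = of_int (\<Sum>k\<in>?A. coeff q k)"
    by (rule at_v_1_eq_sum; auto)+
  ultimately show ?thesis
    by (simp add: Poly_Mapping.lookup_add sum.distrib)
qed

lemma at_v_1_sum: "at_v_1 (sum f A) = (\<Sum>x\<in>A. at_v_1 (f x))"
  by (induction A rule: infinite_finite_induct) (auto simp: at_v_1_add)

lemma at_v_1_diff: "at_v_1 (p - q) = at_v_1 p - at_v_1 q"
  using at_v_1_add[of "p - q" q] by simp

lemma at_v_1_mult: "at_v_1 (p * q) = at_v_1 p * at_v_1 q"
proof -
  have "at_v_1 ((\<Sum>k\<in>K. Poly_Mapping.single k (coeff p k)) *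
      (\<Sum>l\<in>K'. Poly_Mapping.single l (coeff q l)))
    = at_v_1 (\<Sum>k\<in>K. Poly_Mapping.single k (coeff p k)) *
      at_v_1 (\<Sum>l\<in>K'. Poly_Mapping.single l (coeff q l))" for K K'
    by (simp add: sum_product at_v_1_sum Poly_Mapping.mult_single)
  from this[of "Poly_Mapping.keys p" "Poly_Mapping.keys q"] show ?thesis
    by (simp add: poly_mapping_sum_single[symmetric])
qed

text \<open>Picks out one power of v' from a summand of P15, which leaves an identity in
  Z[v, v^-1].\<close>

lemma coeff_in_v'_mult_in_v:
  "coeff (in_v' p * in_v q) k = Poly_Mapping.single 0 (coeff p k) * q"
proof -
  have "coeff (in_v' p * in_v q) k = coeff (Poly_Mapping.single 0 q * in_v' p) k"
    by (simp only: in_v_def mult.commute)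
  also have "\<dots> = q * coeff (in_v' p) k"
    by (simp add: coeff_single_mult)
  also have "coeff (in_v' p) k = Poly_Mapping.single 0 (coeff p k)"
    by (simp add: in_v'_def Poly_Mapping.map.rep_eq when_def)
  finally show ?thesis by (simp only: mult.commute)
qed

text \<open>\<open>p\<close> has no constant term because \<open>2c = 0\<close> forces \<open>c = 0\<close>.\<close>

lemma laurent_bar_antiinvariant:
  assumes "laurent_bar p = - p"
  obtains g where "laurent_bar g - g = p" "\<forall>k\<in>Poly_Mapping.keys g. k < 0"
proof
  have anti: "coeff p (- k) = - coeff p k" for k
    using arg_cong[OF assms, of "\<lambda>f. coeff f k"] by (simp add: coeff_laurent_bar)
  define g where "g = (\<Sum>k\<in>{k\<in>Poly_Mapping.keys p. k < 0}. Poly_Mapping.single k (- coeff p k))"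
  have g: "coeff g k = (if k < 0 then - coeff p k else 0)" for k
    unfolding g_def
    by (simp add: Poly_Mapping.lookup_sum Poly_Mapping.lookup_single when_def sum.delta in_keys_iff)
  show "laurent_bar g - g = p"
  proof (rule poly_mapping_eqI)
    fix k
    show "coeff (laurent_bar g - g) k = coeff p k"
      using anti[of k] anti[of 0]
      by (auto simp: Poly_Mapping.lookup_minus coeff_laurent_bar g)
  qed
  show "\<forall>k\<in>Poly_Mapping.keys g. k < 0"
    by (auto simp: in_keys_iff g split: if_splits)
qed

text \<open>Bar invariance equates the coefficients at k and -k, and one of the two exponents is
  nonnegative. This is the source of the uniqueness of the Kazhdan-Lusztig basis.\<close>

lemma laurent_bar_invariant_neg:
  assumes "laurent_bar p = p" "\<forall>k\<in>Poly_Mapping.keys p. k < 0"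
  shows "p = 0"
proof (rule poly_mapping_eqI)
  fix k
  have "coeff p (- k) = coeff p k"
    using arg_cong[OF assms(1), of "\<lambda>f. coeff f k"] by (simp add: coeff_laurent_bar)
  moreover have "coeff p m = 0" if "m \<ge> 0" for m
    using assms(2) that by (meson in_keys_iff not_le)
  ultimately show "coeff p k = coeff 0 k"
    using linear[of 0 k] by fastforce
qed

section \<open>Free modules\<close>

lemma scale_1 [simp]: "scale 1 f = (f :: 'a \<Rightarrow>\<^sub>0 'b::semiring_1)"
  by (rule poly_mapping_eqI) (simp add: lookup_scale)

lemma scale_zero [simp]: "scale 0 f = 0" "scale c 0 = 0"
  by (rule poly_mapping_eqI, simp add: lookup_scale)+

lemma scale_scale: "scale c (scale d f) = scale (c * d) f"
  by (rule poly_mapping_eqI) (simp add: lookup_scale mult.assoc)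

lemma scale_add_left: "scale (c + d) f = scale c f + scale d f"
  by (rule poly_mapping_eqI) (simp add: lookup_scale Poly_Mapping.lookup_add distrib_right)

lemma scale_diff_left: "scale (c - d) f = scale c f - scale d (f :: 'a \<Rightarrow>\<^sub>0 'b::ring)"
  by (rule poly_mapping_eqI) (simp add: lookup_scale Poly_Mapping.lookup_minus left_diff_distrib)

lemma scale_minus_left: "scale (- c) f = - scale c (f :: 'a \<Rightarrow>\<^sub>0 'b::ring)"
  by (rule poly_mapping_eqI) (simp add: lookup_scale)

lemma scale_sum_right: "scale c (sum f A) = (\<Sum>x\<in>A. scale c (f x))"
  by (rule poly_mapping_eqI) (simp add: lookup_scale Poly_Mapping.lookup_sum sum_distrib_left)

lemma free_mod_iff: "f \<in> free_mod B \<longleftrightarrow> (\<forall>x. x \<notin> B \<longrightarrow> coeff f x = 0)"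
  by (auto simp: free_mod_def in_keys_iff)

lemma free_mod_0 [simp]: "0 \<in> free_mod B"
  by (simp add: free_mod_iff)

lemma free_mod_empty [simp]: "free_mod {} = {0}"
  by (auto simp: free_mod_iff intro: poly_mapping_eqI)

lemma free_mod_single [simp]: "x \<in> B \<Longrightarrow> Poly_Mapping.single x c \<in> free_mod B"
  by (auto simp: free_mod_iff Poly_Mapping.lookup_single when_def)

lemma free_mod_add: "\<lbrakk>f \<in> free_mod B; g \<in> free_mod B\<rbrakk> \<Longrightarrow> f + g \<in> free_mod B"
  by (simp add: free_mod_iff Poly_Mapping.lookup_add)

lemma free_mod_diff:
  "\<lbrakk>f \<in> free_mod B; g \<in> free_mod B\<rbrakk> \<Longrightarrow> f - g \<in> free_mod B"
  for f :: "'a \<Rightarrow>\<^sub>0 'b::ab_group_add"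
  by (simp add: free_mod_iff Poly_Mapping.lookup_minus)

lemma free_mod_scale: "f \<in> free_mod B \<Longrightarrow> scale c f \<in> free_mod B"
  by (simp add: free_mod_iff lookup_scale)

lemma free_mod_sum: "(\<And>x. x \<in> A \<Longrightarrow> f x \<in> free_mod B) \<Longrightarrow> sum f A \<in> free_mod B"
  by (auto simp: free_mod_iff Poly_Mapping.lookup_sum intro!: sum.neutral)

lemma free_mod_mono: "\<lbrakk>f \<in> free_mod A; A \<subseteq> B\<rbrakk> \<Longrightarrow> f \<in> free_mod B"
  by (auto simp: free_mod_iff)

lemma free_mod_expand:
  fixes f :: "'a \<Rightarrow>\<^sub>0 'b::semiring_1"
  assumes "finite B" "f \<in> free_mod B"
  shows "f = (\<Sum>x\<in>B. scale (coeff f x) (Poly_Mapping.single x 1))"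
proof (rule poly_mapping_eqI)
  fix k
  show "coeff f k = coeff (\<Sum>x\<in>B. scale (coeff f x) (Poly_Mapping.single x 1)) k"
    using assms
    by (simp add: Poly_Mapping.lookup_sum lookup_scale Poly_Mapping.lookup_single when_def
        free_mod_iff if_distrib[of "\<lambda>x. _ * x"] sum.delta cong: if_cong)
qed

section \<open>The length function of a Coxeter system\<close>

context coxeter_system
begin

abbreviation len :: "'a \<Rightarrow> nat" where
  "len \<equiv> cox_length G S"

lemma word_prod_Nil [simp]: "word_prod G [] = \<one>"
  by (simp add: word_prod_def)

lemma word_prod_Cons [simp]: "word_prod G (s # ws) = s \<otimes> word_prod G ws"
  by (simp add: word_prod_def)

lemma S_carrier [simp]: "s \<in> S \<Longrightarrow> s \<in> carrier G"
  using S_subset by auto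

lemma word_prod_closed [simp]: "\<forall>x\<in>set ws. x \<in> S \<Longrightarrow> word_prod G ws \<in> carrier G"
  by (induction ws) auto

lemma word_prod_append:
  "\<lbrakk>\<forall>x\<in>set u. x \<in> S; \<forall>x\<in>set w. x \<in> S\<rbrakk> \<Longrightarrow> word_prod G (u @ w) = word_prod G u \<otimes> word_prod G w"
  by (induction u) (auto simp: m_assoc)

lemma S_square [simp]: "s \<in> S \<Longrightarrow> s \<otimes> s = \<one>"
  using S_involutions[of s] pow_ord_eq_1[of s] by (simp add: numeral_2_eq_2)

lemma S_inv [simp]: "s \<in> S \<Longrightarrow> inv s = s"
  by (simp add: inv_equality)

lemma S_cancel [simp]: "\<lbrakk>s \<in> S; x \<in> carrier G\<rbrakk> \<Longrightarrow> s \<otimes> (s \<otimes> x) = x"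
  by (metis S_carrier S_square l_one m_assoc)

lemma word_exists:
  assumes "x \<in> carrier G"
  shows "\<exists>ws\<in>lists S. word_prod G ws = x"
proof -
  have "x \<in> generate G S" using assms S_generates by simp
  then show ?thesis
  proof induction
    case one
    show ?case by (rule bexI[of _ "[]"]) auto
  next
    case (incl h)
    then show ?case by (intro bexI[of _ "[h]"]) auto
  next
    case (inv h)
    then show ?case by (intro bexI[of _ "[h]"]) auto
  next
    case (eng h1 h2)
    then obtain u w where "u \<in> lists S" "word_prod G u = h1" "w \<in> lists S" "word_prod G w = h2"
      by blast
    then show ?case
      by (intro bexI[of _ "u @ w"]) (auto simp: word_prod_append)
  qed
qed

text \<open>Every relator has even length, so the parity of a word depends only on its product: this
  is the sign character. It excludes that s x and x have equal length, a case on which the rules for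
  T_s T_x are silent.\<close>

lemma even_length_word:
  assumes "u \<in> lists S" "w \<in> lists S" "word_prod G u = word_prod G w"
  shows "even (length u) \<longleftrightarrow> even (length w)"
proof -
  have step: "even (length u) \<longleftrightarrow> even (length w)" if "relator_step G S u w" for u w
  proof -
    have "length (concat (replicate n [s, t])) = 2 * n" for n and s t :: 'a
      by (induction n) auto
    then show ?thesis using that unfolding relator_step_def by auto
  qed
  have "equivclp (relator_step G S) u w"
    using presentation assms by blast
  then show ?thesis
    by (induction rule: equivclp_induct) (use step in auto)
qed

lemma reduced_word:
  assumes "x \<in> carrier G"
  obtains ws where "ws \<in> lists S" "word_prod G ws = x" "length ws = len x"
proof -
  obtain ws where "ws \<in> lists S" "word_prod G ws = x"
    using word_exists assms by blast
  then have "\<exists>n. \<exists>ws\<in>lists S. length ws = n \<and> word_prod G ws = x" by blast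
  from LeastI_ex[OF this] show ?thesis
    using that unfolding cox_length_def by blast
qed

lemma len_le: "ws \<in> lists S \<Longrightarrow> len (word_prod G ws) \<le> length ws"
  unfolding cox_length_def by (rule Least_le) auto

lemma len_mult_le:
  assumes "s \<in> S" "x \<in> carrier G"
  shows "len (s \<otimes> x) \<le> len x + 1"
proof -
  obtain ws where "ws \<in> lists S" "word_prod G ws = x" "length ws = len x"
    using reduced_word assms by blast
  then show ?thesis using len_le[of "s # ws"] assms by auto
qed

lemma len_mult_cases:
  assumes "s \<in> S" "x \<in> carrier G"
  shows "len (s \<otimes> x) = len x + 1 \<or> len x = len (s \<otimes> x) + 1"
proof -
  obtain u where u: "u \<in> lists S" "word_prod G u = x" "length u = len x"
    using reduced_word assms by blast
  have "s \<otimes> x \<in> carrier G" using assms by auto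
  then obtain w where w: "w \<in> lists S" "word_prod G w = s \<otimes> x" "length w = len (s \<otimes> x)"
    using reduced_word by blast
  have "even (length (s # u)) \<longleftrightarrow> even (length w)"
    by (rule even_length_word) (use u w assms in auto)
  then have "len x \<noteq> len (s \<otimes> x)" using u w by auto
  then show ?thesis
    using len_mult_le[of s x] len_mult_le[of s "s \<otimes> x"] assms by auto
qed

lemma len_eq_0_iff:
  assumes "x \<in> carrier G"
  shows "len x = 0 \<longleftrightarrow> x = \<one>"
proof
  assume "len x = 0"
  with reduced_word[OF assms] obtain ws where "word_prod G ws = x" "length ws = 0" by metis
  then show "x = \<one>" by simp
next
  assume "x = \<one>"
  then show "len x = 0" using len_le[of "[]"] by simp
qed

lemma len_one [simp]: "len \<one> = 0"
  using len_eq_0_iff by blast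

lemma len_S [simp]: "s \<in> S \<Longrightarrow> len s = 1"
  using len_mult_cases[of s \<one>] by auto

text \<open>Induction along a reduced word, removing its first letter; the tail of a reduced word is
  reduced. The length condition is the one under which \<open>T (s \<otimes> x)\<close> is the
  product of \<open>T s\<close> and \<open>T x\<close>.\<close>

lemma coxeter_induct [consumes 1, case_names one mult]:
  assumes "x \<in> carrier G" and "P \<one>"
    and "\<And>s x. \<lbrakk>s \<in> S; x \<in> carrier G; len (s \<otimes> x) = len x + 1; P x\<rbrakk> \<Longrightarrow> P (s \<otimes> x)"
  shows "P x"
  using assms(1)
proof (induction "len x" arbitrary: x)
  case 0
  then show ?case using len_eq_0_iff assms(2) by simp
next
  case (Suc n)
  obtain ws where ws: "ws \<in> lists S" "word_prod G ws = x" "length ws = len x"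
    using reduced_word Suc by blast
  then obtain s u where su: "ws = s # u" using Suc by (cases ws) auto
  have u: "u \<in> lists S" "s \<in> S" "length u = n" using ws su Suc by auto
  let ?y = "word_prod G u"
  have x: "x = s \<otimes> ?y" using su ws by simp
  have "len ?y = n"
    using len_le[of u] len_mult_le[of s ?y] u Suc x by auto
  with Suc u x show ?case by (auto intro!: assms(3))
qed

lemma len_inv:
  assumes "x \<in> carrier G"
  shows "len (inv x) = len x"
proof -
  have le: "len (inv x) \<le> len x" if x: "x \<in> carrier G" for x
  proof -
    have rev: "word_prod G (rev ws) = inv (word_prod G ws)" if "ws \<in> lists S" for ws
      using that by (induction ws) (auto simp: word_prod_append inv_mult_group)
    obtain ws where "ws \<in> lists S" "word_prod G ws = x" "length ws = len x"
      using reduced_word x by blast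
    then show ?thesis using len_le[of "rev ws"] rev[of ws] by (auto simp: in_lists_conv_set)
  qed
  show ?thesis using le[OF assms] le[of "inv x"] assms by simp
qed

end

section \<open>The bar involution\<close>

context coxeter_system
begin

lemma len_mult_right:
  assumes "s \<in> S" "x \<in> carrier G"
  shows "len (x \<otimes> s) = len (s \<otimes> inv x)"
  using len_inv[of "x \<otimes> s"] assms by (simp add: inv_mult_group)

end

locale finite_hecke_algebra = hecke_algebra G S L H
  for G :: "('w, 'm) monoid_scheme" (structure)
    and S :: "'w set"
    and L :: "'w \<Rightarrow> int"
    and H :: "('w \<Rightarrow>\<^sub>0 laurent, 'n) ring_scheme" +
  assumes finite_W: "finite (carrier G)"
    and L_pos: "s \<in> S \<Longrightarrow> L s > 0"
begin

abbreviation W :: "'w set" where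
  "W \<equiv> carrier G"

abbreviation mult_H (infixl "\<star>" 70) where
  "f \<star> g \<equiv> f \<otimes>\<^bsub>H\<^esub> g"

abbreviation xi :: "'w \<Rightarrow> laurent" where
  "xi s \<equiv> vpow (L s) - vpow (- L s)"

text \<open>The inverse of T_s, solved for in the quadratic relation T_s^2 = T_1 + (v_s - v_s^-1)
  T_s.\<close>

abbreviation Tinv :: "'w \<Rightarrow> ('w \<Rightarrow>\<^sub>0 laurent)" where
  "Tinv s \<equiv> T s - scale (xi s) (T \<one>)"

abbreviation bar :: "('w \<Rightarrow>\<^sub>0 laurent) \<Rightarrow> ('w \<Rightarrow>\<^sub>0 laurent)" where
  "bar \<equiv> hecke_bar G H"

text \<open>The image of \<open>T x\<close> under bar. By \<open>Tbar_mult_up\<close> it is the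
  product of the \<open>Tinv s\<close> along a reduced word of \<open>x\<close>, in the same
  order.\<close>

abbreviation Tbar :: "'w \<Rightarrow> ('w \<Rightarrow>\<^sub>0 laurent)" where
  "Tbar x \<equiv> inv\<^bsub>H\<^esub> (T (inv x))"

text \<open>The length filtration of H. It reaches all of H because W is finite, and the
  triangularity arguments are inductions on \<open>n\<close>.\<close>

abbreviation below :: "nat \<Rightarrow> ('w \<Rightarrow>\<^sub>0 laurent) set" where
  "below n \<equiv> free_mod {x \<in> W. len x < n}"

lemma T_carrier [simp]: "x \<in> W \<Longrightarrow> T x \<in> carrier H"
  by (simp add: carrier_H)

lemma zero_carrier [simp]: "0 \<in> carrier H"
  by (simp add: carrier_H)

lemma add_carrier [simp]: "\<lbrakk>f \<in> carrier H; g \<in> carrier H\<rbrakk> \<Longrightarrow> f + g \<in> carrier H"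
  by (simp add: carrier_H free_mod_add)

lemma diff_carrier [simp]: "\<lbrakk>f \<in> carrier H; g \<in> carrier H\<rbrakk> \<Longrightarrow> f - g \<in> carrier H"
  by (simp add: carrier_H free_mod_diff)

lemma scale_carrier [simp]: "f \<in> carrier H \<Longrightarrow> scale c f \<in> carrier H"
  by (simp add: carrier_H free_mod_scale)

lemma sum_carrier [simp]: "(\<And>x. x \<in> A \<Longrightarrow> f x \<in> carrier H) \<Longrightarrow> sum f A \<in> carrier H"
  by (simp add: carrier_H free_mod_sum)

lemma below_carrier: "f \<in> below n \<Longrightarrow> f \<in> carrier H"
  by (auto simp: carrier_H intro: free_mod_mono)

lemma below_mono: "\<lbrakk>f \<in> below m; m \<le> n\<rbrakk> \<Longrightarrow> f \<in> below n"
  by (erule free_mod_mono) auto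

lemma mult_add_left:
  "\<lbrakk>f \<in> carrier H; g \<in> carrier H; h \<in> carrier H\<rbrakk> \<Longrightarrow> (f + g) \<star> h = f \<star> h + g \<star> h"
  using H.l_distr[of f g h] by (simp add: add_H)

lemma mult_add_right:
  "\<lbrakk>f \<in> carrier H; g \<in> carrier H; h \<in> carrier H\<rbrakk> \<Longrightarrow> h \<star> (f + g) = h \<star> f + h \<star> g"
  using H.r_distr[of f g h] by (simp add: add_H)

lemma mult_diff_left:
  "\<lbrakk>f \<in> carrier H; g \<in> carrier H; h \<in> carrier H\<rbrakk> \<Longrightarrow> (f - g) \<star> h = f \<star> h - g \<star> h"
  using mult_add_left[of "f - g" g h] by (simp add: algebra_simps)

lemma mult_diff_right:
  "\<lbrakk>f \<in> carrier H; g \<in> carrier H; h \<in> carrier H\<rbrakk> \<Longrightarrow> h \<star> (f - g) = h \<star> f - h \<star> g"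
  using mult_add_right[of "f - g" g h] by (simp add: algebra_simps)

lemma mult_zero [simp]:
  "f \<in> carrier H \<Longrightarrow> 0 \<star> f = 0" "f \<in> carrier H \<Longrightarrow> f \<star> 0 = 0"
  using H.l_null[of f] H.r_null[of f] by (simp_all add: zero_H)

lemma mult_sum_left:
  assumes "finite A" "\<And>x. x \<in> A \<Longrightarrow> f x \<in> carrier H" "h \<in> carrier H"
  shows "sum f A \<star> h = (\<Sum>x\<in>A. f x \<star> h)"
  using assms by (induction A rule: finite_induct) (auto simp: mult_add_left)

lemma mult_sum_right:
  assumes "finite A" "\<And>x. x \<in> A \<Longrightarrow> f x \<in> carrier H" "h \<in> carrier H"
  shows "h \<star> sum f A = (\<Sum>x\<in>A. h \<star> f x)"
  using assms by (induction A rule: finite_induct) (auto simp: mult_add_right)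

lemma T_one_mult [simp]: "f \<in> carrier H \<Longrightarrow> T \<one> \<star> f = f" "f \<in> carrier H \<Longrightarrow> f \<star> T \<one> = f"
  using H.l_one[of f] H.r_one[of f] by (simp_all add: one_H)

lemma T_expand: "f \<in> carrier H \<Longrightarrow> f = (\<Sum>x\<in>W. scale (coeff f x) (T x))"
  using free_mod_expand[of W f] finite_W by (simp add: carrier_H)

lemma T_mult_T:
  assumes "s \<in> S" "x \<in> W"
  shows "T s \<star> T x = T (s \<otimes> x) + (if len (s \<otimes> x) < len x then scale (xi s) (T x) else 0)"
  using T_mult_up[of s x] T_mult_down[of s x] len_mult_cases[of s x] assms by auto

lemma T_mult_up': "\<lbrakk>s \<in> S; x \<in> W; len (s \<otimes> x) = len x + 1\<rbrakk> \<Longrightarrow> T s \<star> T x = T (s \<otimes> x)"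
  using T_mult_up[of s x] by simp

lemma Tinv_carrier [simp]: "s \<in> S \<Longrightarrow> Tinv s \<in> carrier H"
  by simp

lemma Tinv_mult: "\<lbrakk>s \<in> S; f \<in> carrier H\<rbrakk> \<Longrightarrow> Tinv s \<star> f = T s \<star> f - scale (xi s) f"
  by (simp add: mult_diff_left scale_mult_H)

lemma T_square: "s \<in> S \<Longrightarrow> T s \<star> T s = T \<one> + scale (xi s) (T s)"
  by (simp add: T_mult_T)

lemma Tinv_T: "s \<in> S \<Longrightarrow> Tinv s \<star> T s = T \<one>"
  by (simp add: Tinv_mult T_square)

lemma T_Tinv: "s \<in> S \<Longrightarrow> T s \<star> Tinv s = T \<one>"
  by (simp add: mult_diff_right mult_scale_H T_square)

lemma Tinv_cancel [simp]: "\<lbrakk>s \<in> S; f \<in> carrier H\<rbrakk> \<Longrightarrow> Tinv s \<star> (T s \<star> f) = f"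
  using H.m_assoc[of "Tinv s" "T s" f] by (simp only: Tinv_T Tinv_carrier T_carrier S_carrier T_one_mult)

lemma T_cancel [simp]: "\<lbrakk>s \<in> S; f \<in> carrier H\<rbrakk> \<Longrightarrow> T s \<star> (Tinv s \<star> f) = f"
  using H.m_assoc[of "T s" "Tinv s" f] by (simp only: T_Tinv Tinv_carrier T_carrier S_carrier T_one_mult)

text \<open>The rules of H describe left multiplication by T_s; associativity along a reduced word
  of x carries the increasing one over to the right side.\<close>

lemma T_mult_right_up:
  assumes "x \<in> W" "s \<in> S" "len (x \<otimes> s) = len x + 1"
  shows "T x \<star> T s = T (x \<otimes> s)"
  using assms
proof (induction rule: coxeter_induct)
  case one
  then show ?case by simp
next
  case (mult t y)
  have "len (y \<otimes> s) \<le> len y + 1"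
    using len_mult_le[of s "inv y"] mult by (simp add: len_mult_right len_inv)
  moreover have "len (t \<otimes> (y \<otimes> s)) \<le> len (y \<otimes> s) + 1"
    using len_mult_le[of t "y \<otimes> s"] mult by simp
  moreover have assoc: "t \<otimes> y \<otimes> s = t \<otimes> (y \<otimes> s)"
    using mult by (simp add: m_assoc)
  \<comment> \<open>The two letters lengthen \<open>y\<close> by two in total, so each of them
    lengthens by exactly one.\<close>
  ultimately have len: "len (y \<otimes> s) = len y + 1" "len (t \<otimes> (y \<otimes> s)) = len (y \<otimes> s) + 1"
    using mult by auto
  have "T (t \<otimes> y) \<star> T s = T t \<star> (T y \<star> T s)"
    using mult H.m_assoc[of "T t" "T y" "T s"] by (simp add: T_mult_up')
  also have "\<dots> = T (t \<otimes> (y \<otimes> s))"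
    using mult len by (simp add: T_mult_up')
  finally show ?case by (simp add: assoc)
qed

lemma T_Units: "x \<in> W \<Longrightarrow> T x \<in> Units H"
proof (induction rule: coxeter_induct)
  case one
  then show ?case using H.Units_one_closed by (simp add: one_H)
next
  case (mult s x)
  have "T s \<in> Units H"
    unfolding Units_def using mult T_Tinv[of s] Tinv_T[of s] Tinv_carrier[of s]
    by (auto simp: one_H simp del: Tinv_carrier)
  with mult show ?case
    using H.Units_m_closed[of "T s" "T x"] by (simp add: T_mult_up')
qed

lemma Tbar_carrier [simp]: "x \<in> W \<Longrightarrow> Tbar x \<in> carrier H"
  by (simp add: T_Units)

lemma inv_T_one [simp]: "inv\<^bsub>H\<^esub> (T \<one>) = T \<one>"
  using H.inv_one by (simp add: one_H)

text \<open>The inverse of s x is x^-1 s with lengths adding up, so its T is a product of two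
  factors, and inversion in H reverses them.\<close>

lemma Tbar_mult_up:
  assumes "s \<in> S" "x \<in> W" "len (s \<otimes> x) = len x + 1"
  shows "Tbar (s \<otimes> x) = Tinv s \<star> Tbar x"
proof -
  have u: "T (inv x) \<in> Units H" using assms T_Units by simp
  have eq: "T (inv (s \<otimes> x)) = T (inv x) \<star> T s"
    using T_mult_right_up[of "inv x" s] assms by (simp add: inv_mult_group len_mult_right len_inv)
  have "(T (inv x) \<star> T s) \<star> (Tinv s \<star> Tbar x) = T (inv x) \<star> (T s \<star> (Tinv s \<star> Tbar x))"
    using assms by (intro H.m_assoc) auto
  also have "\<dots> = \<one>\<^bsub>H\<^esub>" using assms u by simp
  finally have 1: "(T (inv x) \<star> T s) \<star> (Tinv s \<star> Tbar x) = \<one>\<^bsub>H\<^esub>" .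
  have "(Tinv s \<star> Tbar x) \<star> (T (inv x) \<star> T s) = Tinv s \<star> (Tbar x \<star> (T (inv x) \<star> T s))"
    using assms by (intro H.m_assoc) auto
  also have "Tbar x \<star> (T (inv x) \<star> T s) = Tbar x \<star> T (inv x) \<star> T s"
    using assms by (intro H.m_assoc[symmetric]) auto
  also have "Tinv s \<star> \<dots> = \<one>\<^bsub>H\<^esub>"
    using assms u by (simp add: Tinv_T one_H[symmetric]) (simp add: Tinv_T one_H)
  finally have 2: "(Tinv s \<star> Tbar x) \<star> (T (inv x) \<star> T s) = \<one>\<^bsub>H\<^esub>" .
  have "T (inv x) \<star> T s \<in> carrier H" "Tinv s \<star> Tbar x \<in> carrier H"
    using assms by auto
  then show ?thesis
    using H.inv_unique'[OF _ _ 1 2] eq by simp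
qed

text \<open>This is \<open>T_mult_T\<close> with bar applied to every term; the sign changes because
  bar negates \<open>xi s\<close>. It comes before \<open>bar_T_mult\<close>, which it yields by
  semilinearity.\<close>

lemma Tinv_Tbar:
  assumes "s \<in> S" "x \<in> W"
  shows "Tinv s \<star> Tbar x =
    Tbar (s \<otimes> x) - (if len (s \<otimes> x) < len x then scale (xi s) (Tbar x) else 0)"
proof (cases "len (s \<otimes> x) < len x")
  case False
  then show ?thesis
    using len_mult_cases[of s x] assms Tbar_mult_up[of s x] by auto
next
  case True
  then have "len (s \<otimes> (s \<otimes> x)) = len (s \<otimes> x) + 1"
    using len_mult_cases[of s x] assms by auto
  then have "Tbar x = Tinv s \<star> Tbar (s \<otimes> x)"
    using Tbar_mult_up[of s "s \<otimes> x"] assms by simp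
  then have "T s \<star> Tbar x = Tbar (s \<otimes> x)"
    using assms T_cancel[of s "Tbar (s \<otimes> x)"] by simp
  with True show ?thesis using assms by (simp add: Tinv_mult)
qed

lemma bar_eq: "f \<in> carrier H \<Longrightarrow> bar f = (\<Sum>x\<in>W. scale (laurent_bar (coeff f x)) (Tbar x))"
  unfolding hecke_bar_def
  by (rule sum.mono_neutral_left) (auto simp: finite_W carrier_H free_mod_def in_keys_iff)

lemma bar_carrier [simp]: "f \<in> carrier H \<Longrightarrow> bar f \<in> carrier H"
  by (simp add: bar_eq)

lemma bar_add: "\<lbrakk>f \<in> carrier H; g \<in> carrier H\<rbrakk> \<Longrightarrow> bar (f + g) = bar f + bar g"
  by (simp add: bar_eq Poly_Mapping.lookup_add laurent_bar_add scale_add_left sum.distrib)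

lemma bar_diff: "\<lbrakk>f \<in> carrier H; g \<in> carrier H\<rbrakk> \<Longrightarrow> bar (f - g) = bar f - bar g"
  using bar_add[of "f - g" g] by (simp add: algebra_simps)

lemma bar_scale: "f \<in> carrier H \<Longrightarrow> bar (scale c f) = scale (laurent_bar c) (bar f)"
  by (simp add: bar_eq lookup_scale laurent_bar_mult scale_sum_right scale_scale)

lemma bar_0 [simp]: "bar 0 = 0"
  by (simp add: bar_eq)

lemma bar_sum: "(\<And>x. x \<in> A \<Longrightarrow> f x \<in> carrier H) \<Longrightarrow> bar (sum f A) = (\<Sum>x\<in>A. bar (f x))"
  by (induction A rule: infinite_finite_induct) (auto simp: bar_add)

lemma bar_T [simp]: "x \<in> W \<Longrightarrow> bar (T x) = Tbar x"
  by (simp add: bar_eq Poly_Mapping.lookup_single when_def if_distrib[of laurent_bar]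
      if_distrib[of "\<lambda>c. scale c _"] sum.delta finite_W cong: if_cong)

lemma bar_T_mult:
  assumes "s \<in> S" "f \<in> carrier H"
  shows "bar (T s \<star> f) = Tinv s \<star> bar f"
proof -
  have T: "bar (T s \<star> T x) = Tinv s \<star> Tbar x" if "x \<in> W" for x
  proof -
    have "laurent_bar (xi s) = - xi s" by (simp add: laurent_bar_diff)
    then have "scale (laurent_bar (xi s)) (Tbar x) = - scale (xi s) (Tbar x)"
      by (simp only: scale_minus_left)
    then show ?thesis
      using assms that by (simp add: T_mult_T Tinv_Tbar bar_add bar_scale del: minus_diff_eq)
  qed
  have "T s \<star> f = (\<Sum>x\<in>W. scale (coeff f x) (T s \<star> T x))"
    using assms by (subst T_expand[of f]) (simp_all add: mult_sum_right finite_W mult_scale_H)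
  then have "bar (T s \<star> f) = (\<Sum>x\<in>W. scale (laurent_bar (coeff f x)) (Tinv s \<star> Tbar x))"
    using assms by (simp add: bar_sum bar_scale T)
  also have "\<dots> = Tinv s \<star> bar f"
    using assms by (simp add: bar_eq mult_sum_right finite_W mult_scale_H)
  finally show ?thesis .
qed

lemma bar_Tinv_mult:
  assumes "s \<in> S" "f \<in> carrier H"
  shows "bar (Tinv s \<star> f) = T s \<star> bar f"
proof -
  have "bar (T s \<star> (Tinv s \<star> f)) = Tinv s \<star> bar (Tinv s \<star> f)"
    using assms by (intro bar_T_mult) auto
  then have "bar f = Tinv s \<star> bar (Tinv s \<star> f)" using assms by simp
  then show ?thesis using assms by simp
qed

text \<open>Bar turns the product of the \<open>Tinv s\<close> that makes up \<open>Tbar x\<close>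
  back into a product of the \<open>T s\<close>, letter by letter.\<close>

lemma bar_bar:
  assumes "f \<in> carrier H"
  shows "bar (bar f) = f"
proof -
  have T: "bar (Tbar x) = T x" if "x \<in> W" for x
    using that
  proof (induction rule: coxeter_induct)
    case one
    then show ?case by simp
  next
    case (mult s x)
    then show ?case by (simp add: Tbar_mult_up bar_Tinv_mult T_mult_up')
  qed
  have "bar (bar f) = (\<Sum>x\<in>W. scale (coeff f x) (T x))"
    using assms by (simp add: bar_eq[of f] bar_sum bar_scale T)
  then show ?thesis using T_expand[OF assms] by simp
qed

section \<open>Unitriangularity of the bar involution\<close>

lemma Tinv_below:
  assumes "s \<in> S" "f \<in> below n"
  shows "Tinv s \<star> f \<in> below (Suc n)"
proof -
  have f: "f \<in> carrier H" using assms below_carrier by blast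
  have T: "scale c (T s \<star> T x) \<in> below (Suc n)" if "x \<in> W" "len x < n" for x c
    using that assms(1) len_mult_le[of s x]
    by (intro free_mod_scale) (auto simp: T_mult_T intro!: free_mod_add free_mod_scale)
  have "T s \<star> f = (\<Sum>x\<in>W. scale (coeff f x) (T s \<star> T x))"
    using assms f by (subst T_expand[of f]) (simp_all add: mult_sum_right finite_W mult_scale_H)
  also have "\<dots> \<in> below (Suc n)"
  proof (rule free_mod_sum)
    fix x assume "x \<in> W"
    show "scale (coeff f x) (T s \<star> T x) \<in> below (Suc n)"
    proof (cases "len x < n")
      case False
      then have "coeff f x = 0" using assms(2) by (simp add: free_mod_iff)
      then show ?thesis by simp
    qed (use T \<open>x \<in> W\<close> in auto)
  qed
  finally show ?thesis
    using assms f by (simp add: Tinv_mult)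
      (intro free_mod_diff free_mod_scale below_mono[OF assms(2)], auto)
qed

lemma Tbar_unitriangular: "x \<in> W \<Longrightarrow> Tbar x - T x \<in> below (len x)"
proof (induction rule: coxeter_induct)
  case one
  then show ?case by simp
next
  case (mult s x)
  have "Tbar (s \<otimes> x) - T (s \<otimes> x) = Tinv s \<star> (Tbar x - T x) - scale (xi s) (T x)"
  proof -
    have "Tinv s \<star> (Tbar x - T x) = Tinv s \<star> Tbar x - Tinv s \<star> T x"
      using mult by (intro mult_diff_right) auto
    also have "Tinv s \<star> T x = T (s \<otimes> x) - scale (xi s) (T x)"
      using mult by (simp add: Tinv_mult T_mult_up')
    finally show ?thesis using mult by (simp add: Tbar_mult_up)
  qed
  then show ?case
    using mult Tinv_below[of s "Tbar x - T x" "len x"]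
    by (auto intro!: free_mod_diff free_mod_scale)
qed

lemma coeff_Tbar: "\<lbrakk>x \<in> W; y \<in> W; len x \<ge> len y\<rbrakk> \<Longrightarrow> coeff (Tbar y) x = (if x = y then 1 else 0)"
  using Tbar_unitriangular[of y]
  by (auto simp: free_mod_iff Poly_Mapping.lookup_minus Poly_Mapping.lookup_single when_def
      dest: spec[of _ x])

lemma coeff_bar_top:
  assumes "f \<in> below (Suc n)" "x \<in> W" "len x \<ge> n"
  shows "coeff (bar f) x = laurent_bar (coeff f x)"
proof -
  have "coeff (bar f) x = (\<Sum>y\<in>W. laurent_bar (coeff f y) * coeff (Tbar y) x)"
    using below_carrier[OF assms(1)] by (simp add: bar_eq Poly_Mapping.lookup_sum lookup_scale)
  also have "\<dots> = (\<Sum>y\<in>W. if y = x then laurent_bar (coeff f y) else 0)"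
  proof (rule sum.cong[OF refl])
    fix y assume y: "y \<in> W"
    show "laurent_bar (coeff f y) * coeff (Tbar y) x = (if y = x then laurent_bar (coeff f y) else 0)"
    proof (cases "len y \<le> n")
      case True
      then show ?thesis using coeff_Tbar[of x y] y assms by auto
    next
      case False
      then have "coeff f y = 0" using assms(1) by (simp add: free_mod_iff)
      then show ?thesis by auto
    qed
  qed
  also have "\<dots> = laurent_bar (coeff f x)"
    using assms by (simp add: sum.delta finite_W)
  finally show ?thesis .
qed

lemma bar_below:
  assumes "f \<in> below (Suc n)"
  shows "bar f \<in> below (Suc n)"
  unfolding free_mod_iff
proof (intro allI impI)
  fix x assume x: "x \<notin> {x \<in> W. len x < Suc n}"
  show "coeff (bar f) x = 0"
  proof (cases "x \<in> W")
    case True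
    then show ?thesis
      using coeff_bar_top[OF assms, of x] x assms by (simp add: free_mod_iff)
  next
    case False
    then show ?thesis
      using bar_carrier[OF below_carrier[OF assms]] by (simp add: carrier_H free_mod_iff)
  qed
qed

end

section \<open>The Kazhdan--Lusztig basis\<close>

context finite_hecke_algebra
begin

abbreviation C :: "'w \<Rightarrow> ('w \<Rightarrow>\<^sub>0 laurent)" where
  "C \<equiv> kl_basis G H"

abbreviation coords :: "('w \<Rightarrow>\<^sub>0 laurent) \<Rightarrow> ('w \<Rightarrow>\<^sub>0 laurent)" where
  "coords \<equiv> kl_coords G H"

lemma below_SucD:
  assumes "f \<in> below (Suc n)" "\<And>x. \<lbrakk>x \<in> W; len x = n\<rbrakk> \<Longrightarrow> coeff f x = 0"
  shows "f \<in> below n"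
  unfolding free_mod_iff
proof (intro allI impI)
  fix x assume "x \<notin> {x \<in> W. len x < n}"
  then have "x \<notin> {x \<in> W. len x < Suc n} \<or> x \<in> W \<and> len x = n" by auto
  then show "coeff f x = 0" using assms unfolding free_mod_iff by blast
qed

lemma below_all:
  obtains n where "\<And>f. f \<in> carrier H \<Longrightarrow> f \<in> below n"
proof
  fix f assume "f \<in> carrier H"
  moreover have "W \<subseteq> {x \<in> W. len x < Suc (Max (len ` W))}"
    using finite_W by (auto simp: less_Suc_eq_le)
  ultimately show "f \<in> below (Suc (Max (len ` W)))"
    using free_mod_mono by (auto simp: carrier_H)
qed

lemma coeff_sum_T: "X \<subseteq> W \<Longrightarrow> coeff (\<Sum>x\<in>X. scale (g x) (T x)) y = (if y \<in> X then g y else 0)"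
  using finite_subset[OF _ finite_W, of X]
  by (simp add: Poly_Mapping.lookup_sum lookup_scale Poly_Mapping.lookup_single when_def
      if_distrib[of "\<lambda>c. _ * c"] sum.delta cong: if_cong)

text \<open>On the longest elements bar acts coefficientwise, and
  \<open>laurent_bar_antiinvariant\<close> solves the equation there. Subtracting what this solution
  contributes leaves an antiinvariant element one layer lower.\<close>

lemma bar_antiinvariant:
  assumes "f \<in> below n" "bar f = - f"
  shows "\<exists>g\<in>below n. bar g - g = f \<and> (\<forall>x. \<forall>k\<in>Poly_Mapping.keys (coeff g x). k < 0)"
  using assms
proof (induction n arbitrary: f)
  case 0
  then show ?case by simp
next
  case (Suc n)
  let ?X = "{x \<in> W. len x = n}"
  have "\<exists>g. laurent_bar g - g = coeff f x \<and> (\<forall>k\<in>Poly_Mapping.keys g. k < 0)" if x: "x \<in> ?X" for x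
  proof -
    have "laurent_bar (coeff f x) = - coeff f x"
      using coeff_bar_top[OF Suc.prems(1), of x] x Suc.prems(2) by simp
    then show ?thesis using laurent_bar_antiinvariant by blast
  qed
  then have "\<forall>x\<in>?X. \<exists>g. laurent_bar g - g = coeff f x \<and> (\<forall>k\<in>Poly_Mapping.keys g. k < 0)"
    by (rule ballI)
  from bchoice[OF this] obtain g where
    g: "\<And>x. x \<in> ?X \<Longrightarrow> laurent_bar (g x) - g x = coeff f x"
       "\<And>x k. x \<in> ?X \<Longrightarrow> k \<in> Poly_Mapping.keys (g x) \<Longrightarrow> k < 0"
    by blast
  define g0 where "g0 = (\<Sum>x\<in>?X. scale (g x) (T x))"
  have coeff_g0: "coeff g0 x = (if x \<in> ?X then g x else 0)" for x
    unfolding g0_def by (rule coeff_sum_T) auto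
  have g0: "g0 \<in> below (Suc n)"
    by (auto simp: free_mod_iff coeff_g0)
  define f' where "f' = f - (bar g0 - g0)"
  have carr: "f \<in> carrier H" "g0 \<in> carrier H"
    using below_carrier Suc.prems(1) g0 by blast+
  have "f' \<in> below n"
  proof (rule below_SucD)
    show "f' \<in> below (Suc n)"
      unfolding f'_def using g0 Suc.prems(1) bar_below by (intro free_mod_diff) auto
    fix x assume x: "x \<in> W" "len x = n"
    then show "coeff f' x = 0"
      using g(1)[of x] coeff_bar_top[OF g0, of x]
      by (simp add: f'_def Poly_Mapping.lookup_minus coeff_g0)
  qed
  moreover have "bar f' = - f'"
    using carr Suc.prems(2) by (simp add: f'_def bar_diff bar_bar)
  ultimately obtain g1 where g1: "g1 \<in> below n" "bar g1 - g1 = f'"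
    "\<forall>x. \<forall>k\<in>Poly_Mapping.keys (coeff g1 x). k < 0"
    using Suc.IH by blast
  show ?case
  proof (rule bexI[of _ "g1 + g0"], intro conjI allI ballI)
    have "g1 \<in> carrier H" using g1 below_carrier by blast
    then show "bar (g1 + g0) - (g1 + g0) = f"
      using carr g1(2) by (simp add: bar_add f'_def algebra_simps)
    show "g1 + g0 \<in> below (Suc n)"
      using g0 below_mono[OF g1(1)] by (intro free_mod_add) auto
    fix x k assume k: "k \<in> Poly_Mapping.keys (coeff (g1 + g0) x)"
    show "k < 0"
    proof (cases "x \<in> ?X")
      case True
      then have "coeff g1 x = 0" using g1(1) by (auto simp: free_mod_iff)
      then show ?thesis using g(2)[of x k] True k by (simp add: Poly_Mapping.lookup_add coeff_g0)
    next
      case False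
      then show ?thesis using g1(3) k by (auto simp: Poly_Mapping.lookup_add coeff_g0)
    qed
  qed
qed

lemma bar_invariant_neg:
  assumes "g \<in> carrier H" "bar g = g" "\<And>x k. \<lbrakk>x \<in> W; k \<in> Poly_Mapping.keys (coeff g x)\<rbrakk> \<Longrightarrow> k < 0"
  shows "g = 0"
proof -
  have "g = 0" if "g \<in> below n" for n
    using that
  proof (induction n)
    case 0
    then show ?case by simp
  next
    case (Suc n)
    have "g \<in> below n"
    proof (rule below_SucD[OF Suc.prems])
      fix x assume x: "x \<in> W" "len x = n"
      show "coeff g x = 0"
        using coeff_bar_top[OF Suc.prems, of x] x assms(2,3)
        by (intro laurent_bar_invariant_neg) auto
    qed
    then show ?case by (rule Suc.IH)
  qed
  then show ?thesis using below_all assms(1) by metis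
qed

text \<open>The condition inside the definite description of \<open>kl_basis\<close>, named so that
  existence and uniqueness can be stated.\<close>

definition is_kl :: "'w \<Rightarrow> ('w \<Rightarrow>\<^sub>0 laurent) \<Rightarrow> bool" where
  "is_kl y c \<longleftrightarrow> c \<in> carrier H \<and> bar c = c \<and> coeff c y = 1 \<and>
     (\<forall>x\<in>W. x \<noteq> y \<longrightarrow> (\<forall>k\<in>Poly_Mapping.keys (coeff c x). k < 0))"

lemma is_kl_unique:
  assumes "is_kl y c" "is_kl y c'"
  shows "c = c'"
proof -
  have "c - c' = 0"
  proof (rule bar_invariant_neg)
    show "c - c' \<in> carrier H" "bar (c - c') = c - c'"
      using assms by (simp_all add: is_kl_def bar_diff)
    fix x k assume x: "x \<in> W" and k: "k \<in> Poly_Mapping.keys (coeff (c - c') x)"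
    have "x \<noteq> y" using k assms by (auto simp: is_kl_def Poly_Mapping.lookup_minus)
    moreover have "k \<in> Poly_Mapping.keys (coeff c x) \<or> k \<in> Poly_Mapping.keys (coeff c' x)"
      using k by (auto simp: Poly_Mapping.lookup_minus in_keys_iff)
    ultimately show "k < 0" using assms x by (auto simp: is_kl_def)
  qed
  then show ?thesis by simp
qed

text \<open>Since bar is an involution, bar(T_y) - T_y is antiinvariant, hence of the form bar(g) -
  g, and then T_y - g is bar invariant. The second conclusion goes beyond the defining condition; it
  is what makes the elements a basis.\<close>

lemma is_kl_exists:
  assumes "y \<in> W"
  shows "\<exists>c. is_kl y c \<and> c - T y \<in> below (len y)"
proof -
  have f: "Tbar y - T y \<in> below (len y)" using Tbar_unitriangular assms by simp
  have "bar (Tbar y - T y) = bar (bar (T y)) - bar (T y)"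
    using assms by (simp add: bar_diff)
  then have "bar (Tbar y - T y) = - (Tbar y - T y)"
    using assms bar_bar[of "T y"] by simp
  with f obtain g where g: "g \<in> below (len y)" "bar g - g = Tbar y - T y"
    "\<forall>x. \<forall>k\<in>Poly_Mapping.keys (coeff g x). k < 0"
    using bar_antiinvariant by blast
  have gc: "g \<in> carrier H" using g below_carrier by blast
  have gy: "coeff g y = 0" using g(1) by (simp add: free_mod_iff)
  have "is_kl y (T y - g)"
    unfolding is_kl_def
  proof (intro conjI ballI impI)
    show "T y - g \<in> carrier H" using gc assms by simp
    show "bar (T y - g) = T y - g" using gc assms g(2) by (simp add: bar_diff algebra_simps)
    show "coeff (T y - g) y = 1" using gy by (simp add: Poly_Mapping.lookup_minus)
    fix x k assume "x \<noteq> y" "k \<in> Poly_Mapping.keys (coeff (T y - g) x)"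
    then show "k < 0" using g(3)
      by (auto simp: Poly_Mapping.lookup_minus Poly_Mapping.lookup_single when_def)
  qed
  moreover have "(T y - g) - T y \<in> below (len y)"
    using g(1) free_mod_diff[of 0 _ g] by simp
  ultimately show ?thesis by blast
qed

lemma is_kl_C: "y \<in> W \<Longrightarrow> is_kl y (C y)"
proof -
  assume "y \<in> W"
  then obtain c where c: "is_kl y c" using is_kl_exists by blast
  have "C y = (THE c. is_kl y c)" by (simp add: kl_basis_def is_kl_def)
  with c is_kl_unique show ?thesis by (metis theI)
qed

lemma C_eqI: "\<lbrakk>y \<in> W; is_kl y c\<rbrakk> \<Longrightarrow> C y = c"
  using is_kl_C is_kl_unique by blast

lemma C_carrier [simp]: "y \<in> W \<Longrightarrow> C y \<in> carrier H"
  using is_kl_C by (simp add: is_kl_def)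

lemma C_unitriangular: "y \<in> W \<Longrightarrow> C y - T y \<in> below (len y)"
  using is_kl_exists C_eqI by blast

lemma coeff_C: "\<lbrakk>x \<in> W; y \<in> W; len x \<ge> len y\<rbrakk> \<Longrightarrow> coeff (C y) x = (if x = y then 1 else 0)"
  using C_unitriangular[of y]
  by (auto simp: free_mod_iff Poly_Mapping.lookup_minus Poly_Mapping.lookup_single when_def
      dest: spec[of _ x])

lemma C_below: "y \<in> W \<Longrightarrow> C y \<in> below (Suc (len y))"
  using free_mod_add[OF below_mono[OF C_unitriangular, of y "Suc (len y)"], of "T y"] by simp

text \<open>Positivity of L makes v_s^-1 a negative power of v, so the bar invariant element T_s +
  v_s^-1 T_1 meets the characterization. It links \<open>le_L\<close>, generated by the C_s, to the
  T_s.\<close>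

lemma C_S:
  assumes "s \<in> S"
  shows "C s = T s + scale (vpow (- L s)) (T \<one>)"
proof (rule C_eqI)
  have s: "s \<noteq> \<one>" using len_S[OF assms] len_one by auto
  have Ts: "bar (T s) = Tinv s"
    using bar_T_mult[of s "T \<one>"] assms by (simp del: bar_T) (simp add: inv_T_one)
  have "bar (T s + scale (vpow (- L s)) (T \<one>)) = Tinv s + scale (vpow (L s)) (T \<one>)"
    using assms by (simp only: bar_add bar_scale Ts T_carrier scale_carrier S_carrier one_closed
        laurent_bar_vpow minus_minus) (simp add: inv_T_one)
  also have "\<dots> = T s + scale (vpow (- L s)) (T \<one>)"
    by (simp add: scale_diff_left)
  finally have "bar (T s + scale (vpow (- L s)) (T \<one>)) = T s + scale (vpow (- L s)) (T \<one>)" .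
  moreover have "coeff (T s + scale (vpow (- L s)) (T \<one>)) s = 1"
    using s by (simp add: Poly_Mapping.lookup_add lookup_scale Poly_Mapping.lookup_single when_def)
  moreover have "coeff (T s + scale (vpow (- L s)) (T \<one>)) x = (if x = \<one> then vpow (- L s) else 0)"
    if "x \<noteq> s" for x
    using that by (auto simp: Poly_Mapping.lookup_add lookup_scale Poly_Mapping.lookup_single when_def)
  moreover have "\<forall>k\<in>Poly_Mapping.keys (vpow (- L s)). k < 0"
    using L_pos[OF assms] by (simp add: vpow_def)
  ultimately show "is_kl s (T s + scale (vpow (- L s)) (T \<one>))"
    using assms by (simp add: is_kl_def)
qed (use assms in simp)

text \<open>Subtracting the combination of the C_z that matches the top layer of f shortens f. The
  leading coefficients are 1, so this works over Z[v, v^-1] without division.\<close>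

lemma C_expansion_exists: "f \<in> below n \<Longrightarrow> \<exists>c\<in>below n. f = (\<Sum>z\<in>W. scale (coeff c z) (C z))"
proof (induction n arbitrary: f)
  case 0
  then show ?case by simp
next
  case (Suc n)
  let ?X = "{x \<in> W. len x = n}"
  define c0 where "c0 = (\<Sum>x\<in>?X. scale (coeff f x) (T x))"
  have coeff_c0: "coeff c0 x = (if x \<in> ?X then coeff f x else 0)" for x
    unfolding c0_def by (rule coeff_sum_T) auto
  define f0 where "f0 = (\<Sum>z\<in>W. scale (coeff c0 z) (C z))"
  have f0: "f0 \<in> below (Suc n)"
    unfolding f0_def
  proof (rule free_mod_sum)
    fix z assume "z \<in> W"
    then show "scale (coeff c0 z) (C z) \<in> below (Suc n)"
      using C_below[of z] by (auto simp: coeff_c0 intro: free_mod_scale)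
  qed
  have "f - f0 \<in> below n"
  proof (rule below_SucD)
    show "f - f0 \<in> below (Suc n)" using Suc.prems f0 by (rule free_mod_diff)
    fix x assume x: "x \<in> W" "len x = n"
    have "coeff f0 x = (\<Sum>z\<in>W. if z = x then coeff f x else 0)"
      unfolding f0_def Poly_Mapping.lookup_sum lookup_scale
      by (rule sum.cong) (use x in \<open>auto simp: coeff_c0 coeff_C\<close>)
    then show "coeff (f - f0) x = 0"
      using x by (simp add: Poly_Mapping.lookup_minus sum.delta finite_W)
  qed
  then obtain c where c: "c \<in> below n" "f - f0 = (\<Sum>z\<in>W. scale (coeff c z) (C z))"
    using Suc.IH by blast
  show ?case
  proof (rule bexI[of _ "c + c0"])
    show "c + c0 \<in> below (Suc n)"
    proof (rule free_mod_add)
      show "c \<in> below (Suc n)" using c(1) by (rule below_mono) simp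
      show "c0 \<in> below (Suc n)" by (auto simp: free_mod_iff coeff_c0)
    qed
    show "f = (\<Sum>z\<in>W. scale (coeff (c + c0) z) (C z))"
      unfolding Poly_Mapping.lookup_add scale_add_left sum.distrib f0_def[symmetric] c(2)[symmetric]
      by simp
  qed
qed

lemma C_independent:
  assumes "c \<in> carrier H" "(\<Sum>z\<in>W. scale (coeff c z) (C z)) = 0"
  shows "c = 0"
proof -
  have "c = 0" if "c \<in> below n" for n
    using that
  proof (induction n)
    case 0
    then show ?case by simp
  next
    case (Suc n)
    have "c \<in> below n"
    proof (rule below_SucD[OF Suc.prems])
      fix x assume x: "x \<in> W" "len x = n"
      have "coeff (\<Sum>z\<in>W. scale (coeff c z) (C z)) x = (\<Sum>z\<in>W. if z = x then coeff c x else 0)"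
        unfolding Poly_Mapping.lookup_sum lookup_scale
      proof (rule sum.cong[OF refl])
        fix z assume z: "z \<in> W"
        show "coeff c z * coeff (C z) x = (if z = x then coeff c x else 0)"
        proof (cases "len z \<le> n")
          case True
          then show ?thesis using coeff_C[of x z] x z by auto
        next
          case False
          then have "coeff c z = 0" using Suc.prems by (simp add: free_mod_iff)
          then show ?thesis by auto
        qed
      qed
      then show "coeff c x = 0" using assms(2) x by (simp add: sum.delta finite_W)
    qed
    then show ?case by (rule Suc.IH)
  qed
  then show ?thesis using below_all assms(1) by metis
qed

lemma C_expansion_unique:
  assumes "c \<in> carrier H" "c' \<in> carrier H"
    "(\<Sum>z\<in>W. scale (coeff c z) (C z)) = (\<Sum>z\<in>W. scale (coeff c' z) (C z))"
  shows "c = c'"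
proof -
  have "c - c' = 0"
  proof (rule C_independent)
    show "c - c' \<in> carrier H" using assms by simp
    show "(\<Sum>z\<in>W. scale (coeff (c - c') z) (C z)) = 0"
      unfolding Poly_Mapping.lookup_minus scale_diff_left sum_subtractf assms(3) by simp
  qed
  then show ?thesis by simp
qed

lemma sum_keys_C:
  "c \<in> carrier H \<Longrightarrow>
    (\<Sum>z\<in>Poly_Mapping.keys c. scale (coeff c z) (C z)) = (\<Sum>z\<in>W. scale (coeff c z) (C z))"
  by (rule sum.mono_neutral_left) (auto simp: finite_W carrier_H free_mod_def in_keys_iff)

lemma coords_eqI:
  assumes "c \<in> carrier H" "f = (\<Sum>z\<in>W. scale (coeff c z) (C z))"
  shows "coords f = c"
  unfolding kl_coords_def
proof (rule the_equality)
  show "c \<in> free_mod W \<and> f = (\<Sum>z\<in>Poly_Mapping.keys c. scale (coeff c z) (C z))"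
    using assms sum_keys_C by (simp add: carrier_H)
  fix c' assume "c' \<in> free_mod W \<and> f = (\<Sum>z\<in>Poly_Mapping.keys c'. scale (coeff c' z) (C z))"
  then show "c' = c"
    using assms sum_keys_C C_expansion_unique by (simp add: carrier_H)
qed

lemma
  assumes "f \<in> carrier H"
  shows coords_carrier [simp]: "coords f \<in> carrier H"
    and coords_expand: "f = (\<Sum>z\<in>W. scale (coeff (coords f) z) (C z))"
proof -
  obtain n where "f \<in> below n" using below_all assms by metis
  from C_expansion_exists[OF this]
  obtain c where c: "c \<in> carrier H" "f = (\<Sum>z\<in>W. scale (coeff c z) (C z))"
    using below_carrier by blast
  then have "coords f = c" by (rule coords_eqI)
  then show "coords f \<in> carrier H" "f = (\<Sum>z\<in>W. scale (coeff (coords f) z) (C z))"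
    using c by (simp_all only:)
qed

lemma coords_add: "\<lbrakk>f \<in> carrier H; g \<in> carrier H\<rbrakk> \<Longrightarrow> coords (f + g) = coords f + coords g"
  by (intro coords_eqI)
    (simp_all add: Poly_Mapping.lookup_add scale_add_left sum.distrib coords_expand[symmetric])

lemma coords_scale:
  assumes "f \<in> carrier H"
  shows "coords (scale c f) = scale c (coords f)"
proof (rule coords_eqI)
  have "scale c f = scale c (\<Sum>z\<in>W. scale (coeff (coords f) z) (C z))"
    using assms by (simp add: coords_expand[symmetric])
  then show "scale c f = (\<Sum>z\<in>W. scale (coeff (scale c (coords f)) z) (C z))"
    by (simp add: lookup_scale scale_sum_right scale_scale)
qed (use assms in simp)

lemma coords_0 [simp]: "coords 0 = 0"
  by (rule coords_eqI) simp_all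

lemma coords_sum: "(\<And>x. x \<in> A \<Longrightarrow> f x \<in> carrier H) \<Longrightarrow> coords (sum f A) = (\<Sum>x\<in>A. coords (f x))"
  by (induction A rule: infinite_finite_induct) (auto simp: coords_add)

lemma coords_C: "y \<in> W \<Longrightarrow> coords (C y) = T y"
  by (rule coords_eqI)
    (simp_all add: Poly_Mapping.lookup_single when_def if_distrib[of "\<lambda>c. scale c _"] sum.delta finite_W
      cong: if_cong)

section \<open>Matrices of left multiplication in the Kazhdan-Lusztig basis\<close>

definition mat :: "('w \<Rightarrow>\<^sub>0 laurent) \<Rightarrow> 'w \<Rightarrow> 'w \<Rightarrow> laurent" where
  "mat f z y = coeff (coords (f \<star> C y)) z"

lemma kl_h_eq_mat: "kl_h G H x y z = mat (C x) z y"
  by (simp add: kl_h_def mat_def)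

lemma mult_C: "\<lbrakk>f \<in> carrier H; y \<in> W\<rbrakk> \<Longrightarrow> f \<star> C y = (\<Sum>z\<in>W. scale (mat f z y) (C z))"
  by (simp add: mat_def coords_expand[symmetric])

lemma mat_outside: "\<lbrakk>f \<in> carrier H; y \<in> W; z \<notin> W\<rbrakk> \<Longrightarrow> mat f z y = 0"
  using coords_carrier[OF H.m_closed[OF _ C_carrier], of f y]
  by (simp add: mat_def carrier_H free_mod_def in_keys_iff subset_iff) blast

lemma mat_add: "\<lbrakk>f \<in> carrier H; g \<in> carrier H; y \<in> W\<rbrakk> \<Longrightarrow> mat (f + g) z y = mat f z y + mat g z y"
  by (simp add: mat_def mult_add_left coords_add Poly_Mapping.lookup_add)

lemma mat_scale: "\<lbrakk>f \<in> carrier H; y \<in> W\<rbrakk> \<Longrightarrow> mat (scale c f) z y = c * mat f z y"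
  by (simp add: mat_def scale_mult_H coords_scale lookup_scale)

lemma mat_sum:
  "\<lbrakk>finite A; \<And>x. x \<in> A \<Longrightarrow> f x \<in> carrier H; y \<in> W\<rbrakk> \<Longrightarrow> mat (sum f A) z y = (\<Sum>x\<in>A. mat (f x) z y)"
  by (simp add: mat_def mult_sum_left coords_sum Poly_Mapping.lookup_sum)

lemma mat_one: "y \<in> W \<Longrightarrow> mat (T \<one>) z y = (if z = y then 1 else 0)"
  by (simp add: mat_def coords_C Poly_Mapping.lookup_single when_def)

lemma mat_mult:
  assumes "f \<in> carrier H" "g \<in> carrier H" "y \<in> W"
  shows "mat (f \<star> g) z y = (\<Sum>u\<in>W. mat f z u * mat g u y)"
proof -
  have "(f \<star> g) \<star> C y = f \<star> (g \<star> C y)"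
    using assms by (intro H.m_assoc) auto
  also have "\<dots> = (\<Sum>u\<in>W. scale (mat g u y) (f \<star> C u))"
    using assms by (simp add: mult_C[of g] mult_sum_right finite_W mult_scale_H)
  finally show ?thesis
    using assms
    by (simp add: mat_def[of "f \<star> g"] coords_sum coords_scale Poly_Mapping.lookup_sum lookup_scale
        mat_def[of f] mult.commute)
qed

text \<open>Invariance of the trace under a change of basis, with \<open>coeff (C y) u\<close> and
  \<open>coeff (coords (T x)) y\<close> as mutually inverse transition matrices. On the T_x the
  trace can be read off at v = 1.\<close>

lemma trace_mat:
  assumes "f \<in> carrier H"
  shows "(\<Sum>y\<in>W. mat f y y) = (\<Sum>x\<in>W. coeff (f \<star> T x) x)"
proof -
  have "mat f y y = (\<Sum>x\<in>W. \<Sum>u\<in>W. coeff (C y) u * coeff (coords (T x)) y * coeff (f \<star> T u) x)"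
    if y: "y \<in> W" for y
  proof -
    have "f \<star> C y = (\<Sum>u\<in>W. scale (coeff (C y) u) (f \<star> T u))"
      using assms y by (subst T_expand[of "C y"]) (simp_all add: mult_sum_right finite_W mult_scale_H)
    then have fx: "coeff (f \<star> C y) x = (\<Sum>u\<in>W. coeff (C y) u * coeff (f \<star> T u) x)" for x
      by (simp add: Poly_Mapping.lookup_sum lookup_scale)
    have "coords (f \<star> C y) = coords (\<Sum>x\<in>W. scale (coeff (f \<star> C y) x) (T x))"
      using assms y by (simp add: T_expand[symmetric])
    also have "\<dots> = (\<Sum>x\<in>W. scale (coeff (f \<star> C y) x) (coords (T x)))"
      by (simp add: coords_sum coords_scale)
    finally have "mat f y y = (\<Sum>x\<in>W. coeff (f \<star> C y) x * coeff (coords (T x)) y)"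
      by (simp add: mat_def Poly_Mapping.lookup_sum lookup_scale)
    also have "\<dots> = (\<Sum>x\<in>W. \<Sum>u\<in>W. coeff (C y) u * coeff (coords (T x)) y * coeff (f \<star> T u) x)"
      by (simp add: fx sum_distrib_left mult_ac)
    finally show ?thesis .
  qed
  then have "(\<Sum>y\<in>W. mat f y y)
    = (\<Sum>y\<in>W. \<Sum>x\<in>W. \<Sum>u\<in>W. coeff (C y) u * coeff (coords (T x)) y * coeff (f \<star> T u) x)"
    by simp
  also have "\<dots> = (\<Sum>x\<in>W. \<Sum>y\<in>W. \<Sum>u\<in>W. coeff (C y) u * coeff (coords (T x)) y * coeff (f \<star> T u) x)"
    by (rule sum.swap)
  also have "\<dots> = (\<Sum>x\<in>W. \<Sum>u\<in>W. \<Sum>y\<in>W. coeff (C y) u * coeff (coords (T x)) y * coeff (f \<star> T u) x)"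
    by (rule sum.cong[OF refl], rule sum.swap)
  also have "\<dots> = (\<Sum>x\<in>W. \<Sum>u\<in>W. (if u = x then 1 else 0) * coeff (f \<star> T u) x)"
  proof (intro sum.cong refl)
    fix x u assume x: "x \<in> W"
    have "coeff (T x) u = coeff (\<Sum>y\<in>W. scale (coeff (coords (T x)) y) (C y)) u"
      using x by (simp add: coords_expand[symmetric])
    then have "(\<Sum>y\<in>W. coeff (C y) u * coeff (coords (T x)) y) = (if u = x then 1 else 0)"
      by (simp add: Poly_Mapping.lookup_sum lookup_scale Poly_Mapping.lookup_single when_def
          mult.commute eq_commute[of x])
    then show "(\<Sum>y\<in>W. coeff (C y) u * coeff (coords (T x)) y * coeff (f \<star> T u) x)
      = (if u = x then 1 else 0) * coeff (f \<star> T u) x"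
      by (simp only: sum_distrib_right[symmetric])
  qed
  also have "\<dots> = (\<Sum>x\<in>W. coeff (f \<star> T x) x)"
    by (simp add: if_distrib[of "\<lambda>c. c * _"] sum.delta finite_W cong: if_cong)
  finally show ?thesis .
qed

section \<open>Matrix entries and the left preorder\<close>

lemma le_L_refl: "le_L G S H x x"
  by (simp add: le_L_def)

lemma le_L_trans: "\<lbrakk>le_L G S H x y; le_L G S H y z\<rbrakk> \<Longrightarrow> le_L G S H x z"
  unfolding le_L_def by (rule rtranclp_trans)

text \<open>T_s and C_s differ by a multiple of the identity, so an entry off the diagonal is one of
  C_s, a generating step of \<open>le_L\<close>. The diagonal is covered by reflexivity.\<close>

lemma mat_S_le_L:
  assumes "s \<in> S" "y \<in> W" "mat (T s) z y \<noteq> 0"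
  shows "le_L G S H z y"
proof (cases "z = y")
  case True
  then show ?thesis by (simp add: le_L_refl)
next
  case False
  have z: "z \<in> W" using mat_outside[of "T s" y z] assms by auto
  have "kl_h G H s y z = mat (T s) z y"
    using False assms by (simp add: kl_h_eq_mat C_S mat_add mat_scale mat_one)
  then show ?thesis
    unfolding le_L_def using assms z by (intro r_into_rtranclp conjI bexI[of _ s]) auto
qed

text \<open>A nonzero entry of T_x yields, along a reduced word of x, a chain of nonzero entries of
  the T_s, and each of them is a step of the preorder.\<close>

lemma mat_le_L:
  assumes "f \<in> carrier H" "y \<in> W" "mat f z y \<noteq> 0"
  shows "le_L G S H z y"
proof -
  have T: "le_L G S H z y" if "x \<in> W" "y \<in> W" "mat (T x) z y \<noteq> 0" for x y z
    using that
  proof (induction arbitrary: y z rule: coxeter_induct)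
    case one
    then show ?case by (simp add: mat_one le_L_refl split: if_splits)
  next
    case (mult s x)
    have "mat (T (s \<otimes> x)) z y = (\<Sum>u\<in>W. mat (T s) z u * mat (T x) u y)"
      using mult by (simp add: T_mult_up'[symmetric] mat_mult)
    then obtain u where "u \<in> W" "mat (T s) z u * mat (T x) u y \<noteq> 0"
      using mult.prems(2) by (metis (no_types, lifting) sum.neutral)
    then have "le_L G S H z u" "le_L G S H u y"
      using mat_S_le_L mult by auto
    then show ?case by (rule le_L_trans)
  qed
  have "mat f z y = (\<Sum>x\<in>W. coeff f x * mat (T x) z y)"
    using assms by (subst T_expand[of f]) (simp_all add: mat_sum finite_W mat_scale)
  then obtain x where "x \<in> W" "coeff f x * mat (T x) z y \<noteq> 0"
    using assms(3) by (metis (no_types, lifting) sum.neutral)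
  then show ?thesis using T[of x y z] assms(2) by auto
qed

end

section \<open>Specialization at \<open>v = 1\<close>\<close>

context finite_hecke_algebra
begin

text \<open>At v = 1 the factor \<open>xi s\<close> vanishes and T_w becomes left translation by w,
  so the coefficient at x comes from the one at w^-1 x.\<close>

lemma at_v_1_coeff_T_mult:
  assumes "w \<in> W" "f \<in> carrier H" "x \<in> W"
  shows "at_v_1 (coeff (T w \<star> f) x) = at_v_1 (coeff f (inv w \<otimes> x))"
proof -
  have S: "at_v_1 (coeff (T s \<star> f) x) = at_v_1 (coeff f (s \<otimes> x))"
    if "s \<in> S" "f \<in> carrier H" "x \<in> W" for s f x
  proof -
    have "T s \<star> f = (\<Sum>y\<in>W. scale (coeff f y) (T s \<star> T y))"
      using that by (subst T_expand[of f]) (simp_all add: mult_sum_right finite_W mult_scale_H)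
    then have "at_v_1 (coeff (T s \<star> f) x) = (\<Sum>y\<in>W. at_v_1 (coeff f y) * at_v_1 (coeff (T s \<star> T y) x))"
      by (simp add: Poly_Mapping.lookup_sum lookup_scale at_v_1_sum at_v_1_mult)
    also have "\<dots> = (\<Sum>y\<in>W. if y = s \<otimes> x then at_v_1 (coeff f y) else 0)"
    proof (rule sum.cong[OF refl])
      fix y assume y: "y \<in> W"
      have "s \<otimes> y = x \<longleftrightarrow> y = s \<otimes> x" using that y by auto
      then have "at_v_1 (coeff (T s \<star> T y) x) = (if y = s \<otimes> x then 1 else 0)"
        using that y
        by (simp add: T_mult_T Poly_Mapping.lookup_add lookup_scale Poly_Mapping.lookup_single when_def
            at_v_1_add at_v_1_mult at_v_1_diff)
      then show "at_v_1 (coeff f y) * at_v_1 (coeff (T s \<star> T y) x)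
        = (if y = s \<otimes> x then at_v_1 (coeff f y) else 0)" by simp
    qed
    also have "\<dots> = at_v_1 (coeff f (s \<otimes> x))"
      using that by (simp add: sum.delta finite_W)
    finally show ?thesis .
  qed
  show ?thesis
    using assms(1,3)
  proof (induction arbitrary: x rule: coxeter_induct)
    case one
    then show ?case using assms(2) by simp
  next
    case (mult s w)
    have "T (s \<otimes> w) \<star> f = T s \<star> (T w \<star> f)"
      using mult assms(2) H.m_assoc[of "T s" "T w" f] by (simp add: T_mult_up')
    then show ?case
      using mult assms(2) by (simp add: S inv_mult_group m_assoc)
  qed
qed

lemma at_v_1_coeff_T_T:
  "\<lbrakk>w \<in> W; u \<in> W; x \<in> W\<rbrakk> \<Longrightarrow> at_v_1 (coeff (T w \<star> T u) x) = (if x = w \<otimes> u then 1 else 0)"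
  using inv_solve_left'[of u w x]
  by (auto simp: at_v_1_coeff_T_mult Poly_Mapping.lookup_single when_def)

text \<open>\<open>act\<close> is the regular representation of \<open>W\<close> in the specialized Kazhdan--Lusztig basis; \<open>gact\<close> is
  its associated graded module, the direct sum of all left cell modules.\<close>

definition act :: "'w \<Rightarrow> 'w \<Rightarrow> 'w \<Rightarrow> complex" where
  "act w z y = at_v_1 (mat (T w) z y)"

definition gact :: "'w \<Rightarrow> 'w \<Rightarrow> 'w \<Rightarrow> complex" where
  "gact w z y = (if sim_L G S H z y then act w z y else 0)"

lemma at_v_1_mat:
  assumes "f \<in> carrier H" "y \<in> W"
  shows "at_v_1 (mat f z y) = (\<Sum>x\<in>W. at_v_1 (coeff f x) * act x z y)"
proof -
  have "mat f z y = (\<Sum>x\<in>W. coeff f x * mat (T x) z y)"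
    using assms by (subst T_expand[of f]) (simp_all add: mat_sum finite_W mat_scale)
  then show ?thesis by (simp add: at_v_1_sum at_v_1_mult act_def)
qed

lemma act_mult:
  assumes "w \<in> W" "u \<in> W" "y \<in> W"
  shows "(\<Sum>t\<in>W. act w z t * act u t y) = act (w \<otimes> u) z y"
proof -
  have "(\<Sum>t\<in>W. act w z t * act u t y) = at_v_1 (mat (T w \<star> T u) z y)"
    using assms by (simp add: mat_mult at_v_1_sum at_v_1_mult act_def)
  also have "\<dots> = (\<Sum>x\<in>W. if x = w \<otimes> u then act x z y else 0)"
    using assms by (subst at_v_1_mat) (auto simp: at_v_1_coeff_T_T intro!: sum.cong)
  also have "\<dots> = act (w \<otimes> u) z y"
    using assms by (simp add: sum.delta finite_W)
  finally show ?thesis .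
qed

lemma act_le_L: "\<lbrakk>w \<in> W; y \<in> W; act w z y \<noteq> 0\<rbrakk> \<Longrightarrow> le_L G S H z y"
  using mat_le_L[of "T w" y z] by (cases "mat (T w) z y = 0") (auto simp: act_def)

lemma sim_L_refl [simp]: "sim_L G S H x x"
  by (simp add: sim_L_def le_L_refl)

lemma sim_L_sym: "sim_L G S H x y \<Longrightarrow> sim_L G S H y x"
  by (simp add: sim_L_def)

lemma sim_L_trans: "\<lbrakk>sim_L G S H x y; sim_L G S H y z\<rbrakk> \<Longrightarrow> sim_L G S H x z"
  unfolding sim_L_def using le_L_trans by blast

text \<open>For z ~ y a nonzero term of the untruncated product has z \<le> t \<le> y, which puts t
  into the same cell; for z, y in different cells no t is equivalent to both.\<close>

lemma gact_mult:
  assumes "w \<in> W" "u \<in> W" "y \<in> W"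
  shows "(\<Sum>t\<in>W. gact w z t * gact u t y) = gact (w \<otimes> u) z y"
proof (cases "sim_L G S H z y")
  case True
  have "(\<Sum>t\<in>W. gact w z t * gact u t y) = (\<Sum>t\<in>W. act w z t * act u t y)"
  proof (rule sum.cong[OF refl])
    fix t assume t: "t \<in> W"
    have "sim_L G S H z t" "sim_L G S H t y" if "act w z t \<noteq> 0" "act u t y \<noteq> 0"
      using act_le_L[OF assms(1) t that(1)] act_le_L[OF assms(2,3) that(2)] True le_L_trans
      unfolding sim_L_def by blast+
    then show "gact w z t * gact u t y = act w z t * act u t y"
      by (auto simp: gact_def)
  qed
  with True show ?thesis using assms by (simp add: act_mult gact_def)
next
  case False
  have "gact w z t * gact u t y = 0" for t
    using sim_L_trans[of z t y] False by (auto simp: gact_def)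
  then have "(\<Sum>t\<in>W. gact w z t * gact u t y) = 0" by (intro sum.neutral) blast
  with False show ?thesis by (simp add: gact_def)
qed

text \<open>Diagonal entries survive the truncation, so the trace can be taken in the basis T_x,
  where w permutes W by left translation, without fixed points unless w = 1.\<close>

lemma gact_trace:
  assumes "w \<in> W"
  shows "(\<Sum>y\<in>W. gact w y y) = (if w = \<one> then of_nat (card W) else 0)"
proof -
  have "(\<Sum>y\<in>W. gact w y y) = at_v_1 (\<Sum>y\<in>W. mat (T w) y y)"
    by (simp add: gact_def act_def at_v_1_sum)
  also have "\<dots> = (\<Sum>x\<in>W. at_v_1 (coeff (T w \<star> T x) x))"
    using assms by (simp add: trace_mat at_v_1_sum)
  also have "\<dots> = (\<Sum>x\<in>W. if w = \<one> then 1 else 0)"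
  proof (rule sum.cong[OF refl])
    fix x assume x: "x \<in> W"
    have "x = w \<otimes> x \<longleftrightarrow> w = \<one>" using assms x r_cancel_one'[of x w] by simp
    then show "at_v_1 (coeff (T w \<star> T x) x) = (if w = \<one> then 1 else 0)"
      using assms x by (simp add: at_v_1_coeff_T_T)
  qed
  finally show ?thesis by simp
qed

lemma left_cellE:
  assumes "CC \<in> left_cells G S H"
  obtains "CC \<subseteq> W" "CC \<noteq> {}" "\<And>y z. \<lbrakk>y \<in> CC; z \<in> W\<rbrakk> \<Longrightarrow> z \<in> CC \<longleftrightarrow> sim_L G S H z y"
proof -
  obtain x where x: "x \<in> W" "CC = {y \<in> W. sim_L G S H x y}"
    using assms unfolding left_cells_def by (auto elim!: quotientE)
  show ?thesis
  proof (rule that)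
    show "CC \<subseteq> W" "CC \<noteq> {}" using x by auto
    fix y z assume "y \<in> CC" "z \<in> W"
    then show "z \<in> CC \<longleftrightarrow> sim_L G S H z y"
      using x sim_L_sym sim_L_trans by blast
  qed
qed

end

section \<open>The asymptotic ring\<close>

locale lusztig_hecke_algebra = finite_hecke_algebra G S L H
  for G :: "('w, 'm) monoid_scheme" (structure)
    and S :: "'w set"
    and L :: "'w \<Rightarrow> int"
    and H :: "('w \<Rightarrow>\<^sub>0 laurent, 'n) ring_scheme" +
  assumes P1_to_P15: "P1_to_P15 G S H"
begin

abbreviation a :: "'w \<Rightarrow> nat" where
  "a \<equiv> a_fun G H"

text \<open>A \<open>LEAST\<close> has its property once some number has it: as W is finite, the
  exponents of all the Laurent polynomials involved are bounded by some M, and \<open>nat M\<close>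
  is such a number.\<close>

lemma coeff_kl_h_above_a:
  assumes "x \<in> W" "y \<in> W" "k > int (a z)"
  shows "coeff (kl_h G H x y z) k = 0"
proof -
  let ?K = "\<Union>x\<in>W. \<Union>y\<in>W. Poly_Mapping.keys (kl_h G H x y z)"
  have "finite ?K" using finite_W by auto
  then obtain M where "\<forall>k\<in>?K. k \<le> M"
    using bdd_above_finite unfolding bdd_above_def by blast
  then have "\<forall>x\<in>W. \<forall>y\<in>W. \<forall>k\<in>Poly_Mapping.keys (kl_h G H x y z). k \<le> int (nat M)"
    by fastforce
  then have "\<forall>x\<in>W. \<forall>y\<in>W. \<forall>k\<in>Poly_Mapping.keys (kl_h G H x y z). k \<le> int (a z)"
    unfolding a_fun_def by (rule LeastI)
  then show ?thesis using assms by (metis in_keys_iff not_le)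
qed

lemma gam_eq: "u \<in> W \<Longrightarrow> gam G H x y (inv u) = coeff (kl_h G H x y u) (int (a u))"
  by (simp add: gam_def vpow_def coeff_single_mult)

text \<open>\<open>rmult x\<close> is the matrix of right multiplication by \<open>t\<^sub>x\<close> in the asymptotic ring with
  \<open>t\<^sub>w t\<^sub>x = \<Sum>\<^sub>z \<gamma>\<^sub>w\<^sub>,\<^sub>x\<^sub>,\<^sub>z\<^sup>-\<^sup>1 t\<^sub>z\<close>, whose identity is \<open>\<Sum>\<^sub>d unit_J d \<cdot> t\<^sub>d\<close>.\<close>

definition rmult :: "'w \<Rightarrow> 'w \<Rightarrow> 'w \<Rightarrow> complex" where
  "rmult x z w = of_int (gam G H w x (inv z))"

definition unit_J :: "'w \<Rightarrow> complex" where
  "unit_J d = (if d \<in> dist_set G H then of_int (n_coeff G H d) else 0)"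

section \<open>Consequences of Lusztig's properties\<close>

lemma
  shows P2: "P2 G H" and P3: "P3 G H" and P4: "P4 G S H" and P5: "P5 G H" and P7: "P7 G H"
    and P8: "P8 G S H" and P9: "P9 G S H" and P13: "P13 G S H" and P15: "P15 G H"
  using P1_to_P15 unfolding P1_to_P15_def by iprover+

lemma a_antimono_L: "\<lbrakk>x \<in> W; y \<in> W; le_L G S H x y\<rbrakk> \<Longrightarrow> a y \<le> a x"
  by (rule P4[unfolded P4_def, rule_format]) (auto simp: le_LR_def)

lemma a_antimono_R: "\<lbrakk>x \<in> W; y \<in> W; le_R G S H x y\<rbrakk> \<Longrightarrow> a y \<le> a x"
  by (rule P4[unfolded P4_def, rule_format]) (auto simp: le_LR_def)

lemma a_eq_L: "\<lbrakk>x \<in> W; y \<in> W; sim_L G S H x y\<rbrakk> \<Longrightarrow> a x = a y"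
  using a_antimono_L unfolding sim_L_def by (meson le_antisym)

lemma a_eq_inv_L: "\<lbrakk>x \<in> W; y \<in> W; sim_L G S H (inv x) (inv y)\<rbrakk> \<Longrightarrow> a x = a y"
  using a_antimono_R unfolding sim_L_def le_R_def by (meson le_antisym)

lemma sim_L_if_a_eq: "\<lbrakk>x \<in> W; y \<in> W; le_L G S H x y; a x = a y\<rbrakk> \<Longrightarrow> sim_L G S H x y"
  using P9 unfolding P9_def by blast

text \<open>P8 for a nonzero entry. Right multiplication by t_x starts in the left cell of x^-1 and
  ends in that of x, which explains the index set of the final basis; the third relation keeps it
  inside a right cell, so that a is constant.\<close>

lemma rmult_cells:
  assumes "x \<in> W" "z \<in> W" "w \<in> W" "rmult x z w \<noteq> 0"
  shows "sim_L G S H w (inv x)" "sim_L G S H x z" "sim_L G S H (inv z) (inv w)"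
proof -
  have g: "gam G H w x (inv z) \<noteq> 0" using assms by (simp add: rmult_def)
  show "sim_L G S H w (inv x)" "sim_L G S H x z" "sim_L G S H (inv z) (inv w)"
    using P8[unfolded P8_def, rule_format, OF assms(3,1) inv_closed[OF assms(2)] g] assms by simp_all
qed

lemma rmult_a: "\<lbrakk>x \<in> W; z \<in> W; w \<in> W; rmult x z w \<noteq> 0\<rbrakk> \<Longrightarrow> a z = a w"
  using rmult_cells(3) a_eq_inv_L by blast

text \<open>The analogue of \<open>gact\<close> for arbitrary elements of H: P15 is about the C_x,
  while W acts through the T_w.\<close>

definition gmat :: "('w \<Rightarrow>\<^sub>0 laurent) \<Rightarrow> 'w \<Rightarrow> 'w \<Rightarrow> complex" where
  "gmat f z y = (if sim_L G S H z y then at_v_1 (mat f z y) else 0)"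

text \<open>Compare the coefficients of \<open>v'\<^sup>a\<close>, \<open>a = a(w) = a(y)\<close>, on both sides of P15.\<close>

lemma gmat_C_commute:
  assumes "x \<in> W" "x' \<in> W" "w \<in> W" "y \<in> W"
  shows "(\<Sum>y'\<in>W. gmat (C x) y y' * rmult x' y' w) = (\<Sum>y'\<in>W. rmult x' y y' * gmat (C x) y' w)"
proof (cases "a w = a y")
  \<comment> \<open>P15 says nothing here, but truncation to cells and right multiplication both
    preserve a, so every term leading from \<open>w\<close> to \<open>y\<close> is zero.\<close>
  case False
  have "gmat (C x) y y' * rmult x' y' w = 0" if "y' \<in> W" for y'
  proof (rule ccontr)
    assume "\<not> ?thesis"
    then have "sim_L G S H y y'" "rmult x' y' w \<noteq> 0" by (auto simp: gmat_def split: if_splits)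
    then show False using False a_eq_L[of y y'] rmult_a[of x' y' w] that assms by simp
  qed
  moreover have "rmult x' y y' * gmat (C x) y' w = 0" if "y' \<in> W" for y'
  proof (rule ccontr)
    assume "\<not> ?thesis"
    then have "sim_L G S H y' w" "rmult x' y y' \<noteq> 0" by (auto simp: gmat_def split: if_splits)
    then show False using False a_eq_L[of y' w] rmult_a[of x' y y'] that assms by simp
  qed
  ultimately show ?thesis by (simp only: sum.neutral_const cong: sum.cong)
next
  case True
  have "(\<Sum>y'\<in>W. in_v' (kl_h G H w x' y') * in_v (kl_h G H x y' y)) =
     (\<Sum>y'\<in>W. in_v (kl_h G H x w y') * in_v' (kl_h G H y' x' y))"
    by (rule P15[unfolded P15_def, rule_format]) (use True assms in auto)
  also have "\<dots> = (\<Sum>y'\<in>W. in_v' (kl_h G H y' x' y) * in_v (kl_h G H x w y'))"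
    by (rule sum.cong[OF refl], rule mult.commute)
  finally have "coeff (\<Sum>y'\<in>W. in_v' (kl_h G H w x' y') * in_v (kl_h G H x y' y)) (int (a y)) =
     coeff (\<Sum>y'\<in>W. in_v' (kl_h G H y' x' y) * in_v (kl_h G H x w y')) (int (a y))"
    by (rule arg_cong)
  then have "(\<Sum>y'\<in>W. Poly_Mapping.single 0 (coeff (kl_h G H w x' y') (int (a y))) * kl_h G H x y' y) =
     (\<Sum>y'\<in>W. Poly_Mapping.single 0 (coeff (kl_h G H y' x' y) (int (a y))) * kl_h G H x w y')"
    by (simp only: Poly_Mapping.lookup_sum coeff_in_v'_mult_in_v)
  then have "at_v_1 (\<Sum>y'\<in>W. Poly_Mapping.single 0 (coeff (kl_h G H w x' y') (int (a y))) * kl_h G H x y' y) =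
     at_v_1 (\<Sum>y'\<in>W. Poly_Mapping.single 0 (coeff (kl_h G H y' x' y) (int (a y))) * kl_h G H x w y')"
    by (rule arg_cong)
  then have top: "(\<Sum>y'\<in>W. of_int (coeff (kl_h G H w x' y') (int (a y))) * at_v_1 (mat (C x) y y')) =
     (\<Sum>y'\<in>W. of_int (coeff (kl_h G H y' x' y) (int (a y))) * at_v_1 (mat (C x) y' w))"
    by (simp add: at_v_1_sum at_v_1_mult kl_h_eq_mat[of x])
  \<comment> \<open>The coefficient was taken at a(y), but gamma is read off at a(y'). A nonzero
    entry of C_x forces a(y') \<le> a(y): if it is smaller, both sides vanish; if it is equal, P9
    makes y and y' equivalent.\<close>
  have "gmat (C x) y y' * rmult x' y' w
      = of_int (coeff (kl_h G H w x' y') (int (a y))) * at_v_1 (mat (C x) y y')"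
    if y': "y' \<in> W" for y'
  proof (cases "mat (C x) y y' = 0")
    case True
    then show ?thesis by (simp add: gmat_def)
  next
    case False
    then have le: "le_L G S H y y'" using mat_le_L[of "C x" y' y] assms y' by simp
    then have "a y' \<le> a y" using a_antimono_L[of y y'] assms y' by simp
    then consider "a y' < a y" | "a y' = a y" by linarith
    then show ?thesis
    proof cases
      case 1
      then show ?thesis
        using coeff_kl_h_above_a[of w x' y' "int (a y)"] a_eq_L[of y y'] assms y'
        by (auto simp: gmat_def)
    next
      case 2
      then show ?thesis
        using sim_L_if_a_eq[OF assms(4) y' le] y' by (simp add: gmat_def rmult_def gam_eq)
    qed
  qed
  \<comment> \<open>Here the target is \<open>y\<close>, so the coefficient at a(y) is gamma itself.
    Where it is nonzero, a(y') = a(y) = a(w), and P9 applies again.\<close>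
  moreover have "rmult x' y y' * gmat (C x) y' w
      = of_int (coeff (kl_h G H y' x' y) (int (a y))) * at_v_1 (mat (C x) y' w)"
    if y': "y' \<in> W" for y'
  proof -
    have r: "rmult x' y y' = of_int (coeff (kl_h G H y' x' y) (int (a y)))"
      using assms by (simp add: rmult_def gam_eq)
    have "sim_L G S H y' w" if "rmult x' y y' \<noteq> 0" "mat (C x) y' w \<noteq> 0"
      using sim_L_if_a_eq[of y' w] mat_le_L[of "C x" w y'] rmult_a[of x' y y'] True that assms y'
      by auto
    then show ?thesis
      using r by (cases "rmult x' y y' = 0"; cases "mat (C x) y' w = 0") (auto simp: gmat_def)
  qed
  ultimately show ?thesis using top by simp
qed

text \<open>Both sides are linear in the acting element, so expanding T_u in the Kazhdan-Lusztig
  basis reduces this to \<open>gmat_C_commute\<close>.\<close>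

lemma gact_commute:
  assumes "u \<in> W" "x \<in> W" "w \<in> W" "y \<in> W"
  shows "(\<Sum>t\<in>W. gact u y t * rmult x t w) = (\<Sum>t\<in>W. rmult x y t * gact u t w)"
proof -
  have g: "gact u z y = (\<Sum>t\<in>W. at_v_1 (coeff (coords (T u)) t) * gmat (C t) z y)"
    if "y \<in> W" for z y
  proof -
    have "T u = (\<Sum>t\<in>W. scale (coeff (coords (T u)) t) (C t))"
      using assms by (simp add: coords_expand[symmetric])
    then have "mat (T u) z y = mat (\<Sum>t\<in>W. scale (coeff (coords (T u)) t) (C t)) z y"
      by (rule arg_cong)
    also have "\<dots> = (\<Sum>t\<in>W. coeff (coords (T u)) t * mat (C t) z y)"
      using that by (simp add: mat_sum finite_W mat_scale)
    finally show ?thesis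
      by (simp add: gact_def act_def gmat_def at_v_1_sum at_v_1_mult)
  qed
  have "(\<Sum>t\<in>W. gact u y t * rmult x t w)
    = (\<Sum>t\<in>W. \<Sum>r\<in>W. at_v_1 (coeff (coords (T u)) r) * (gmat (C r) y t * rmult x t w))"
    by (simp add: g sum_distrib_right mult.assoc)
  also have "\<dots> = (\<Sum>r\<in>W. at_v_1 (coeff (coords (T u)) r) * (\<Sum>t\<in>W. gmat (C r) y t * rmult x t w))"
    by (subst sum.swap) (simp add: sum_distrib_left)
  also have "\<dots> = (\<Sum>r\<in>W. at_v_1 (coeff (coords (T u)) r) * (\<Sum>t\<in>W. rmult x y t * gmat (C r) t w))"
    using assms by (simp add: gmat_C_commute)
  also have "\<dots> = (\<Sum>t\<in>W. \<Sum>r\<in>W. at_v_1 (coeff (coords (T u)) r) * (rmult x y t * gmat (C r) t w))"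
    by (subst sum.swap) (simp add: sum_distrib_left)
  also have "\<dots> = (\<Sum>t\<in>W. rmult x y t * gact u t w)"
    using assms by (simp add: g sum_distrib_left mult.left_commute)
  finally show ?thesis .
qed

text \<open>P7 moves d to the last position, where P2 forces z = x: each t_d t_x is a multiple of
  t_x.\<close>

lemma rmult_dist:
  assumes "x \<in> W" "z \<in> W" "d \<in> dist_set G H"
  shows "rmult x z d = (if x = z then of_int (gam G H x (inv x) d) else 0)"
proof -
  have d: "d \<in> W" using assms by (simp add: dist_set_def)
  have "gam G H d x (inv z) = gam G H x (inv z) d"
    and "gam G H x (inv z) d \<noteq> 0 \<Longrightarrow> x = inv (inv z)"
    using P7[unfolded P7_def, rule_format, OF d assms(1) inv_closed[OF assms(2)]]
      P2[unfolded P2_def, rule_format, OF assms(3,1) inv_closed[OF assms(2)]] by blast+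
  then show ?thesis using assms by (auto simp: rmult_def)
qed

text \<open>In the ring: 1_J t_x = t_x. By P3, applied to x^-1, exactly one d contributes, and by P5
  its term is the square of n_d = 1 or -1.\<close>

lemma unit_J_left:
  assumes "x \<in> W" "z \<in> W"
  shows "(\<Sum>d\<in>W. rmult x z d * unit_J d) = (if x = z then 1 else 0)"
proof -
  have "(\<Sum>d\<in>W. rmult x z d * unit_J d) = (\<Sum>d\<in>dist_set G H. rmult x z d * of_int (n_coeff G H d))"
    by (rule sum.mono_neutral_cong_right) (auto simp: finite_W dist_set_def unit_J_def)
  also have "\<dots> = (if x = z then \<Sum>d\<in>dist_set G H. of_int (gam G H x (inv x) d * n_coeff G H d) else 0)"
    using assms by (auto simp: rmult_dist intro!: sum.neutral)
  also have "\<dots> = (if x = z then 1 else 0)"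
  proof -
    have inv: "inv x \<in> W" "inv (inv x) = x" using assms by auto
    obtain d where d: "d \<in> dist_set G H" "gam G H x (inv x) d \<noteq> 0"
      and uniq: "\<And>d'. \<lbrakk>d' \<in> dist_set G H; gam G H x (inv x) d' \<noteq> 0\<rbrakk> \<Longrightarrow> d' = d"
      using P3[unfolded P3_def, rule_format, OF inv(1)] inv(2) by auto
    have "gam G H x (inv x) d = n_coeff G H d" "n_coeff G H d = 1 \<or> n_coeff G H d = -1"
      using P5[unfolded P5_def, rule_format, OF d(1) inv(1)] inv d(2) by simp_all
    then have "gam G H x (inv x) d * n_coeff G H d = 1" by auto
    moreover have "finite (dist_set G H)" using finite_W by (simp add: dist_set_def)
    then have "(\<Sum>d\<in>dist_set G H. gam G H x (inv x) d * n_coeff G H d)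
      = (\<Sum>d\<in>{d}. gam G H x (inv x) d * n_coeff G H d)"
    proof (rule sum.mono_neutral_right)
      show "\<forall>d'\<in>dist_set G H - {d}. gam G H x (inv x) d' * n_coeff G H d' = 0"
        using uniq by (metis DiffE insertI1 mult_zero_left)
    qed (use d in auto)
    ultimately have "(\<Sum>d\<in>dist_set G H. gam G H x (inv x) d * n_coeff G H d) = 1" by simp
    then show ?thesis by (simp only: of_int_sum[symmetric] of_int_1)
  qed
  finally show ?thesis .
qed

end

section \<open>Homomorphisms between left cell modules\<close>

lemma sum_fun_apply: "(\<Sum>x\<in>A. f x) m = (\<Sum>x\<in>A. f x m)"
  for f :: "_ \<Rightarrow> _ \<Rightarrow> 'c::comm_monoid_add"
  by (induction A rule: infinite_finite_induct) auto

text \<open>The hypothesis makes the rows \<open>b w\<close> linearly independent; being as many as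
  the dimension of the space of functions on \<open>A\<close>, they span it.\<close>

lemma square_system_solvable:
  fixes b :: "'a \<Rightarrow> 'a \<Rightarrow> 'b::field"
  assumes "finite A"
    and inj: "\<And>c. (\<And>z. z \<in> A \<Longrightarrow> (\<Sum>w\<in>A. c w * b w z) = 0) \<Longrightarrow> \<forall>w\<in>A. c w = 0"
  obtains c where "\<And>z. z \<in> A \<Longrightarrow> (\<Sum>w\<in>A. c w * b w z) = v z"
proof -
  interpret V: vector_space "\<lambda>(c::'b) (f::'a \<Rightarrow> 'b) x. c * f x"
    by unfold_locales (auto simp: fun_eq_iff algebra_simps)
  define b' where "b' w = (\<lambda>z. if z \<in> A then b w z else 0)" for w
  define e where "e w = (\<lambda>z. if z = w then 1 else 0 :: 'b)" for w :: 'a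
  have sum_apply: "(\<Sum>w\<in>A. (\<lambda>x. c w * f w x)) z = (\<Sum>w\<in>A. c w * f w z)"
    for c :: "'a \<Rightarrow> 'b" and f :: "'a \<Rightarrow> 'a \<Rightarrow> 'b" and z
    using assms(1) by (induction A rule: finite_induct) auto
  have span_e: "f \<in> V.span (e ` A)" if "\<And>z. z \<notin> A \<Longrightarrow> f z = 0" for f
  proof -
    have "f = (\<Sum>w\<in>A. (\<lambda>x. f w * e w x))"
    proof
      fix z
      show "f z = (\<Sum>w\<in>A. (\<lambda>x. f w * e w x)) z"
        unfolding sum_apply using assms(1) that[of z]
        by (simp add: e_def if_distrib[of "\<lambda>c. _ * c"] sum.delta' cong: if_cong)
    qed
    also have "\<dots> \<in> V.span (e ` A)"
      by (intro V.span_sum V.span_scale V.span_base) auto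
    finally show ?thesis .
  qed
  have zero: "\<forall>w\<in>A. c w = 0" if c: "(\<Sum>w\<in>A. (\<lambda>x. c w * b' w x)) = 0" for c
  proof (rule inj)
    fix z assume "z \<in> A"
    then show "(\<Sum>w\<in>A. c w * b w z) = 0"
      using fun_cong[OF c, of z] unfolding sum_apply by (simp add: b'_def)
  qed
  \<comment> \<open>The image of \<open>A\<close> under \<open>b'\<close> is a set and forgets
    repetitions. Two equal rows would give a relation with coefficients 1 and -1.\<close>
  have inj_b: "inj_on b' A"
  proof (rule inj_onI, rule ccontr)
    fix u w assume uw: "u \<in> A" "w \<in> A" "b' u = b' w" "u \<noteq> w"
    define c where "c t = (if t = u then 1 else 0) - (if t = w then 1 else 0 :: 'b)" for t
    have "(\<Sum>t\<in>A. (\<lambda>x. c t * b' t x)) = 0"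
    proof
      fix z
      show "(\<Sum>t\<in>A. (\<lambda>x. c t * b' t x)) z = 0 z"
        unfolding sum_apply using uw assms(1)
        by (simp add: c_def left_diff_distrib sum_subtractf if_distrib[of "\<lambda>c. c * _"] sum.delta'
            sum.delta cong: if_cong)
    qed
    from zero[OF this] uw show False by (auto simp: c_def)
  qed
  have indep: "V.independent (b' ` A)"
  proof (rule V.independent_if_scalars_zero)
    fix f x assume s: "(\<Sum>x\<in>b' ` A. (\<lambda>z. f x * x z)) = 0" and "x \<in> b' ` A"
    have "(\<Sum>w\<in>A. (\<lambda>z. f (b' w) * b' w z)) = 0"
      using s by (simp add: sum.reindex[OF inj_b] o_def)
    from zero[OF this] \<open>x \<in> b' ` A\<close> show "f x = 0" by auto
  qed (use assms(1) in simp)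
  have fin: "finite (e ` A)" using assms(1) by simp
  \<comment> \<open>A vector outside the span would give \<open>card A\<close> + 1 independent
    vectors in the span of at most \<open>card A\<close> vectors.\<close>
  have "V.span (e ` A) \<subseteq> V.span (b' ` A)"
  proof (rule subsetI, rule ccontr)
    fix f assume f: "f \<in> V.span (e ` A)" "f \<notin> V.span (b' ` A)"
    then have "V.independent (insert f (b' ` A))"
      using indep by (intro V.independent_insertI)
    moreover have "insert f (b' ` A) \<subseteq> V.span (e ` A)"
      using f span_e by (auto simp: b'_def)
    ultimately have "card (insert f (b' ` A)) \<le> card (e ` A)"
      using V.independent_span_bound[OF fin] by blast
    also have "\<dots> \<le> card A" using assms(1) by (rule card_image_le)
    moreover have "f \<notin> b' ` A" using f V.span_base by blast
    ultimately show False using inj_b assms(1) by (simp add: card_image)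
  qed
  moreover have "(\<lambda>z. if z \<in> A then v z else 0) \<in> V.span (e ` A)"
    by (rule span_e) auto
  ultimately have "(\<lambda>z. if z \<in> A then v z else 0) \<in> V.span (b' ` A)" by blast
  then obtain u where u: "(\<Sum>f\<in>b' ` A. (\<lambda>x. u f * f x)) = (\<lambda>z. if z \<in> A then v z else 0)"
    using V.span_finite[of "b' ` A"] assms(1) by auto
  have "(\<Sum>w\<in>A. u (b' w) * b w z) = v z" if "z \<in> A" for z
  proof -
    have "(\<Sum>w\<in>A. (\<lambda>x. u (b' w) * b' w x)) z = v z"
      using u that by (simp add: sum.reindex[OF inj_b] o_def)
    then show ?thesis unfolding sum_apply using that by (simp add: b'_def)
  qed
  then show thesis by (rule that)
qed

section \<open>The commutant of the W-action on the graded module\<close>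

context lusztig_hecke_algebra
begin

lemma sum_mult_sum: "(\<Sum>t\<in>W. f t * (\<Sum>d\<in>W. g t d * u d)) = (\<Sum>d\<in>W. (\<Sum>t\<in>W. f t * g t d) * u d)"
  for f u :: "'w \<Rightarrow> complex"
proof -
  have "(\<Sum>t\<in>W. f t * (\<Sum>d\<in>W. g t d * u d)) = (\<Sum>t\<in>W. \<Sum>d\<in>W. f t * g t d * u d)"
    by (simp add: sum_distrib_left mult.assoc)
  also have "\<dots> = (\<Sum>d\<in>W. \<Sum>t\<in>W. f t * g t d * u d)"
    by (rule sum.swap)
  finally show ?thesis by (simp add: sum_distrib_right)
qed

definition lact :: "('w \<Rightarrow> complex) \<Rightarrow> 'w \<Rightarrow> 'w \<Rightarrow> complex" where
  "lact c z y = (\<Sum>w\<in>W. c w * gact w z y)"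

lemma lact_commute:
  assumes "\<And>w. w \<in> W \<Longrightarrow> (\<Sum>t\<in>W. F z t * gact w t y) = (\<Sum>t\<in>W. gact w z t * F t y)"
  shows "(\<Sum>t\<in>W. F z t * lact c t y) = (\<Sum>t\<in>W. lact c z t * F t y)"
proof -
  have "(\<Sum>t\<in>W. F z t * lact c t y) = (\<Sum>t\<in>W. \<Sum>w\<in>W. c w * (F z t * gact w t y))"
    by (simp add: lact_def sum_distrib_left mult.left_commute)
  also have "\<dots> = (\<Sum>w\<in>W. c w * (\<Sum>t\<in>W. F z t * gact w t y))"
    by (subst sum.swap) (simp add: sum_distrib_left)
  also have "\<dots> = (\<Sum>w\<in>W. c w * (\<Sum>t\<in>W. gact w z t * F t y))"
    by (simp add: assms)
  also have "\<dots> = (\<Sum>t\<in>W. \<Sum>w\<in>W. c w * (gact w z t * F t y))"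
    by (subst sum.swap) (simp add: sum_distrib_left)
  also have "\<dots> = (\<Sum>t\<in>W. lact c z t * F t y)"
    by (simp add: lact_def sum_distrib_right mult.assoc)
  finally show ?thesis .
qed

text \<open>The identity h t_x = (h 1_J) t_x read at t_z, where h is the group algebra element with
  coefficients \<open>c\<close>: insert \<open>unit_J_left\<close>, then let h pass the right
  multiplication by t_x.\<close>

lemma lact_eq_unit_J:
  assumes "x \<in> W" "z \<in> W"
  shows "lact c z x = (\<Sum>t\<in>W. rmult x z t * (\<Sum>d\<in>W. lact c t d * unit_J d))"
proof -
  have comm: "(\<Sum>t\<in>W. lact c z t * rmult x t d) = (\<Sum>t\<in>W. rmult x z t * lact c t d)"
    if "d \<in> W" for d
    by (rule lact_commute[symmetric], rule gact_commute[symmetric]) (use that assms in auto)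
  have "lact c z x = (\<Sum>t\<in>W. lact c z t * (if x = t then 1 else 0))"
    using assms by (simp add: if_distrib[of "\<lambda>c. _ * c"] sum.delta finite_W cong: if_cong)
  also have "\<dots> = (\<Sum>t\<in>W. lact c z t * (\<Sum>d\<in>W. rmult x t d * unit_J d))"
    using assms by (simp add: unit_J_left)
  also have "\<dots> = (\<Sum>d\<in>W. (\<Sum>t\<in>W. lact c z t * rmult x t d) * unit_J d)"
    by (rule sum_mult_sum)
  also have "\<dots> = (\<Sum>d\<in>W. (\<Sum>t\<in>W. rmult x z t * lact c t d) * unit_J d)"
    by (simp add: comm)
  also have "\<dots> = (\<Sum>t\<in>W. rmult x z t * (\<Sum>d\<in>W. lact c t d * unit_J d))"
    by (rule sum_mult_sum[symmetric])
  finally show ?thesis .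
qed

text \<open>By \<open>gact_trace\<close> the trace of u^-1 h is |W| times the coefficient of h at u,
  and it is zero if h acts by zero.\<close>

lemma lact_eq_0:
  assumes "\<And>z y. \<lbrakk>z \<in> W; y \<in> W\<rbrakk> \<Longrightarrow> lact c z y = 0" "u \<in> W"
  shows "c u = 0"
proof -
  have "(\<Sum>z\<in>W. \<Sum>y\<in>W. gact (inv u) z y * lact c y z) = 0"
    using assms by simp
  also have "(\<Sum>z\<in>W. \<Sum>y\<in>W. gact (inv u) z y * lact c y z)
    = (\<Sum>z\<in>W. \<Sum>w\<in>W. c w * (\<Sum>y\<in>W. gact (inv u) z y * gact w y z))"
    by (simp add: lact_def sum_distrib_left mult.left_commute, rule sum.cong[OF refl], rule sum.swap)
  also have "\<dots> = (\<Sum>z\<in>W. \<Sum>w\<in>W. c w * gact (inv u \<otimes> w) z z)"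
    using assms(2) by (simp add: gact_mult)
  also have "\<dots> = (\<Sum>w\<in>W. c w * (\<Sum>z\<in>W. gact (inv u \<otimes> w) z z))"
    by (subst sum.swap) (simp add: sum_distrib_left)
  also have "\<dots> = (\<Sum>w\<in>W. if w = u then c w * of_nat (card W) else 0)"
  proof (rule sum.cong[OF refl])
    fix w assume w: "w \<in> W"
    have "inv u \<otimes> w = \<one> \<longleftrightarrow> w = u"
      using inv_solve_left'[of \<one> u w] w assms(2) by auto
    then show "c w * (\<Sum>z\<in>W. gact (inv u \<otimes> w) z z) = (if w = u then c w * of_nat (card W) else 0)"
      using w assms(2) by (simp add: gact_trace)
  qed
  also have "\<dots> = c u * of_nat (card W)"
    using assms(2) by (simp add: sum.delta finite_W)
  finally show ?thesis
    using finite_W assms(2) by auto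
qed

text \<open>The group algebra acts faithfully because of the trace form, and an element acting by \<open>0\<close> on
  the identity of the asymptotic ring acts by \<open>0\<close>. Counting dimensions, every \<open>t\<^sub>y\<close> is the image of
  the identity under some element of the group algebra.\<close>

lemma lact_unit_J_surj:
  obtains c where "\<And>z. z \<in> W \<Longrightarrow> (\<Sum>d\<in>W. lact c z d * unit_J d) = v z"
proof -
  let ?b = "\<lambda>w z. \<Sum>d\<in>W. gact w z d * unit_J d"
  have b: "(\<Sum>w\<in>W. c w * ?b w z) = (\<Sum>d\<in>W. lact c z d * unit_J d)" for c z
    unfolding lact_def by (rule sum_mult_sum)
  have "\<forall>w\<in>W. c w = 0" if "\<And>z. z \<in> W \<Longrightarrow> (\<Sum>w\<in>W. c w * ?b w z) = 0" for c
  proof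
    fix w assume w: "w \<in> W"
    show "c w = 0"
    proof (rule lact_eq_0[OF _ w])
      fix z y assume "z \<in> W" "y \<in> W"
      then show "lact c z y = 0"
        by (subst lact_eq_unit_J) (simp_all add: that[unfolded b])
    qed
  qed
  from square_system_solvable[where b="?b" and v=v, OF finite_W this]
  obtain c where "\<And>z. z \<in> W \<Longrightarrow> (\<Sum>w\<in>W. c w * ?b w z) = v z" by blast
  then show thesis using that unfolding b by blast
qed

text \<open>Let psi be the endomorphism with matrix F and h a group algebra element with h 1_J =
  t_y. Then psi(t_y) = h psi(1_J) = t_y psi(1_J); the inner sum is the coefficient of psi(1_J) at
  t_x.\<close>

lemma commutant_rmult:
  assumes F: "\<And>w z y. \<lbrakk>w \<in> W; z \<in> W; y \<in> W\<rbrakk> \<Longrightarrow>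
      (\<Sum>t\<in>W. F z t * gact w t y) = (\<Sum>t\<in>W. gact w z t * F t y)"
    and "z \<in> W" "y \<in> W"
  shows "F z y = (\<Sum>x\<in>W. (\<Sum>d\<in>W. F x d * unit_J d) * rmult x z y)"
proof -
  obtain c where c: "\<And>t. t \<in> W \<Longrightarrow> (\<Sum>d\<in>W. lact c t d * unit_J d) = (if t = y then 1 else 0)"
    using lact_unit_J_surj[where v="\<lambda>t. if t = y then 1 else 0"] by blast
  \<comment> \<open>The chosen h acts as left multiplication by t_y.\<close>
  have M: "lact c z x = rmult x z y" if "x \<in> W" for x
  proof -
    have "lact c z x = (\<Sum>t\<in>W. rmult x z t * (if t = y then 1 else 0))"
      by (subst lact_eq_unit_J) (simp_all add: that assms(2) c)
    then show ?thesis
      using assms(3) by (simp add: if_distrib[of "\<lambda>c. _ * c"] sum.delta finite_W cong: if_cong)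
  qed
  have "F z y = (\<Sum>t\<in>W. F z t * (\<Sum>d\<in>W. lact c t d * unit_J d))"
    using assms(3) c by (simp add: if_distrib[of "\<lambda>c. _ * c"] sum.delta finite_W cong: if_cong)
  also have "\<dots> = (\<Sum>d\<in>W. (\<Sum>t\<in>W. F z t * lact c t d) * unit_J d)"
    by (rule sum_mult_sum)
  also have "\<dots> = (\<Sum>d\<in>W. (\<Sum>t\<in>W. lact c z t * F t d) * unit_J d)"
    by (rule sum.cong[OF refl], subst lact_commute) (use F assms(2) in auto)
  also have "\<dots> = (\<Sum>t\<in>W. lact c z t * (\<Sum>d\<in>W. F t d * unit_J d))"
    by (rule sum_mult_sum[symmetric])
  also have "\<dots> = (\<Sum>x\<in>W. (\<Sum>d\<in>W. F x d * unit_J d) * rmult x z y)"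
    by (simp add: M mult.commute)
  finally show ?thesis .
qed

end

section \<open>Homomorphisms as intertwining matrices\<close>

context finite_hecke_algebra
begin

lemma coeff_sum_single:
  "finite A \<Longrightarrow> coeff (\<Sum>z\<in>A. Poly_Mapping.single z (g z)) x = (if x \<in> A then g x else 0)"
  by (simp add: Poly_Mapping.lookup_sum Poly_Mapping.lookup_single when_def sum.delta)

lemma coeff_cell_act:
  assumes "CC \<subseteq> W" "m \<in> free_mod CC" "w \<in> W"
  shows "coeff (cell_act G H CC w m) z = (if z \<in> CC then \<Sum>y\<in>CC. coeff m y * act w z y else 0)"
proof -
  have fin: "finite CC" using assms(1) finite_W finite_subset by blast
  have A: "coeff (cell_act_A G H CC (T w) (T y)) z = (if z \<in> CC then mat (T w) z y else 0)" for z y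
    using fin by (simp add: cell_act_A_def coeff_sum_single mat_def)
  define g where "g y = (\<Sum>z\<in>CC. Poly_Mapping.single z
    (at_v_1 (coeff (cell_act_A G H CC (T w) (T y)) z)))" for y
  have g: "coeff (g y) z = (if z \<in> CC then act w z y else 0)" for y z
    unfolding g_def coeff_sum_single[OF fin] A act_def by simp
  have "cell_act G H CC w m = (\<Sum>y\<in>CC. scale (coeff m y) (g y))"
    unfolding cell_act_def g_def
    by (rule sum.mono_neutral_left) (use assms fin in \<open>auto simp: free_mod_def in_keys_iff\<close>)
  then show ?thesis
    by (simp add: Poly_Mapping.lookup_sum lookup_scale g)
qed

text \<open>The value zero off \<open>free_mod CC\<close> follows the convention of
  \<open>Hom_W\<close>, so that a homomorphism is determined by its matrix also as a
  function.\<close>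

definition mat_hom :: "'w set \<Rightarrow> 'w set \<Rightarrow> ('w \<Rightarrow> 'w \<Rightarrow> complex) \<Rightarrow> ('w \<Rightarrow>\<^sub>0 complex) \<Rightarrow> ('w \<Rightarrow>\<^sub>0 complex)"
where
  "mat_hom CC CC' F m = (if m \<in> free_mod CC then
     \<Sum>z\<in>CC'. Poly_Mapping.single z (\<Sum>y\<in>CC. F z y * coeff m y) else 0)"

lemma coeff_mat_hom:
  assumes "CC' \<subseteq> W"
  shows "coeff (mat_hom CC CC' F m) z =
    (if m \<in> free_mod CC \<and> z \<in> CC' then \<Sum>y\<in>CC. F z y * coeff m y else 0)"
  using finite_subset[OF assms finite_W] by (simp add: mat_hom_def coeff_sum_single)

lemma mat_hom_in_Hom_W:
  assumes "CC \<subseteq> W" "CC' \<subseteq> W"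
    and F: "\<And>w z y. \<lbrakk>w \<in> W; z \<in> CC'; y \<in> CC\<rbrakk> \<Longrightarrow>
      (\<Sum>t\<in>CC. F z t * act w t y) = (\<Sum>t\<in>CC'. act w z t * F t y)"
  shows "mat_hom CC CC' F \<in> Hom_W G H CC CC'"
proof -
  note coeff = coeff_mat_hom[OF assms(2)]
  have closed: "mat_hom CC CC' F m \<in> free_mod CC'" for m
    by (simp add: free_mod_iff coeff)
  have zero: "mat_hom CC CC' F m = 0" if "m \<notin> free_mod CC" for m
    using that by (simp add: mat_hom_def)
  note closed
  moreover have "mat_hom CC CC' F (m + m') = mat_hom CC CC' F m + mat_hom CC CC' F m'"
    if "m \<in> free_mod CC" "m' \<in> free_mod CC" for m m'
    using that
    by (intro poly_mapping_eqI)
      (simp add: coeff Poly_Mapping.lookup_add free_mod_add distrib_left sum.distrib)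
  moreover have "mat_hom CC CC' F (scale c m) = scale c (mat_hom CC CC' F m)"
    if "m \<in> free_mod CC" for c m
    using that
    by (intro poly_mapping_eqI)
      (simp add: coeff lookup_scale free_mod_scale sum_distrib_left mult.left_commute)
  moreover have "mat_hom CC CC' F (cell_act G H CC w m) = cell_act G H CC' w (mat_hom CC CC' F m)"
    if w: "w \<in> W" and m: "m \<in> free_mod CC" for w m
  proof (rule poly_mapping_eqI)
    fix z
    have act: "cell_act G H CC w m \<in> free_mod CC"
      using coeff_cell_act[OF assms(1) m w] by (simp add: free_mod_iff)
    show "coeff (mat_hom CC CC' F (cell_act G H CC w m)) z
      = coeff (cell_act G H CC' w (mat_hom CC CC' F m)) z"
    proof (cases "z \<in> CC'")
      case True
      have "(\<Sum>t\<in>CC. F z t * (\<Sum>y\<in>CC. coeff m y * act w t y))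
        = (\<Sum>t\<in>CC. \<Sum>y\<in>CC. coeff m y * (F z t * act w t y))"
        by (simp add: sum_distrib_left mult.left_commute)
      also have "\<dots> = (\<Sum>y\<in>CC. coeff m y * (\<Sum>t\<in>CC. F z t * act w t y))"
        by (subst sum.swap) (simp add: sum_distrib_left)
      also have "\<dots> = (\<Sum>y\<in>CC. coeff m y * (\<Sum>t\<in>CC'. act w z t * F t y))"
        using F[OF w True] by simp
      also have "\<dots> = (\<Sum>t\<in>CC'. \<Sum>y\<in>CC. coeff m y * (act w z t * F t y))"
        by (subst sum.swap) (simp add: sum_distrib_left)
      also have "\<dots> = (\<Sum>t\<in>CC'. (\<Sum>y\<in>CC. F t y * coeff m y) * act w z t)"
        by (simp only: sum_distrib_right) (simp only: mult_ac)
      finally show ?thesis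
        using True act m
        by (simp add: coeff coeff_cell_act[OF assms(1) m w] coeff_cell_act[OF assms(2) closed w])
    next
      case False
      then show ?thesis by (simp add: coeff coeff_cell_act[OF assms(2) closed w])
    qed
  qed
  ultimately show ?thesis
    unfolding Hom_W_def using zero by blast
qed

text \<open>Converse of \<open>mat_hom_in_Hom_W\<close>: the images of the basis vectors form a
  matrix that recovers the map, and equivariance on basis vectors is the intertwining
  relation.\<close>

lemma Hom_W_matrix:
  assumes "CC \<subseteq> W" "CC' \<subseteq> W" "\<phi> \<in> Hom_W G H CC CC'"
  defines "F \<equiv> \<lambda>z y. coeff (\<phi> (Poly_Mapping.single y 1)) z"
  shows Hom_W_eq_mat_hom: "\<phi> = mat_hom CC CC' F"
    and Hom_W_matrix_equivariant: "\<And>w z y. \<lbrakk>w \<in> W; z \<in> CC'; y \<in> CC\<rbrakk> \<Longrightarrow>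
      (\<Sum>t\<in>CC. F z t * act w t y) = (\<Sum>t\<in>CC'. act w z t * F t y)"
proof -
  have fin: "finite CC" using assms(1) finite_W finite_subset by blast
  have hom:
    "\<And>m. m \<in> free_mod CC \<Longrightarrow> \<phi> m \<in> free_mod CC'"
    "\<And>m. m \<notin> free_mod CC \<Longrightarrow> \<phi> m = 0"
    "\<And>m m'. \<lbrakk>m \<in> free_mod CC; m' \<in> free_mod CC\<rbrakk> \<Longrightarrow> \<phi> (m + m') = \<phi> m + \<phi> m'"
    "\<And>c m. m \<in> free_mod CC \<Longrightarrow> \<phi> (scale c m) = scale c (\<phi> m)"
    "\<And>w m. \<lbrakk>w \<in> W; m \<in> free_mod CC\<rbrakk> \<Longrightarrow> \<phi> (cell_act G H CC w m) = cell_act G H CC' w (\<phi> m)"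
    using assms(3) unfolding Hom_W_def by blast+
  have zero: "\<phi> 0 = 0" using hom(4)[of 0 0] by simp
  have sum: "\<phi> (\<Sum>y\<in>A. f y) = (\<Sum>y\<in>A. \<phi> (f y))"
    if "finite A" "\<And>y. y \<in> A \<Longrightarrow> f y \<in> free_mod CC" for A and f :: "'w \<Rightarrow> ('w \<Rightarrow>\<^sub>0 complex)"
    using that by (induction A rule: finite_induct) (auto simp: zero hom(3) free_mod_sum)
  have coeff: "coeff (\<phi> m) z = (\<Sum>y\<in>CC. F z y * coeff m y)" if m: "m \<in> free_mod CC" for m z
  proof -
    have "\<phi> m = \<phi> (\<Sum>y\<in>CC. scale (coeff m y) (Poly_Mapping.single y 1))"
      using free_mod_expand[OF fin m] by (rule arg_cong)
    also have "\<dots> = (\<Sum>y\<in>CC. scale (coeff m y) (\<phi> (Poly_Mapping.single y 1)))"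
      using fin by (simp add: sum free_mod_scale hom(4))
    finally show ?thesis
      by (simp add: F_def Poly_Mapping.lookup_sum lookup_scale mult.commute)
  qed
  show "\<phi> = mat_hom CC CC' F"
  proof (rule ext, rule poly_mapping_eqI)
    fix m z
    show "coeff (\<phi> m) z = coeff (mat_hom CC CC' F m) z"
    proof (cases "m \<in> free_mod CC")
      case True
      then have "z \<notin> CC' \<Longrightarrow> coeff (\<phi> m) z = 0"
        using hom(1) free_mod_iff by blast
      with True show ?thesis by (simp add: coeff_mat_hom[OF assms(2)] coeff)
    qed (simp add: hom(2) coeff_mat_hom[OF assms(2)])
  qed
  fix w z y assume w: "w \<in> W" and z: "z \<in> CC'" and y: "y \<in> CC"
  have single: "Poly_Mapping.single y 1 \<in> free_mod CC" using y by simp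
  have act: "coeff (cell_act G H CC w (Poly_Mapping.single y 1)) t = (if t \<in> CC then act w t y else 0)"
    for t
    using coeff_cell_act[OF assms(1) single w] y fin
    by (simp add: Poly_Mapping.lookup_single when_def if_distrib[of "\<lambda>c. c * _"] sum.delta' sum.delta cong: if_cong)
  then have "cell_act G H CC w (Poly_Mapping.single y 1) \<in> free_mod CC"
    by (simp add: free_mod_iff)
  from coeff[OF this, of z]
  have "coeff (\<phi> (cell_act G H CC w (Poly_Mapping.single y 1))) z = (\<Sum>t\<in>CC. F z t * act w t y)"
    by (simp add: act)
  moreover have "coeff (cell_act G H CC' w (\<phi> (Poly_Mapping.single y 1))) z = (\<Sum>t\<in>CC'. act w z t * F t y)"
    using coeff_cell_act[OF assms(2) hom(1)[OF single] w] z by (simp add: F_def mult.commute)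
  ultimately show "(\<Sum>t\<in>CC. F z t * act w t y) = (\<Sum>t\<in>CC'. act w z t * F t y)"
    using hom(5)[OF w single] by simp
qed

end

section \<open>A basis of the homomorphism space\<close>

context lusztig_hecke_algebra
begin

text \<open>\<open>CC\<close> is a full equivalence class, so \<open>gact\<close> is block diagonal
  with \<open>act\<close> in the block of \<open>CC\<close>. This lets sums over a cell be exchanged
  with sums over W.\<close>

lemma gact_left_cell:
  assumes "CC \<in> left_cells G S H" "y \<in> W" "z \<in> W" "y \<in> CC \<or> z \<in> CC"
  shows "gact w z y = (if y \<in> CC \<and> z \<in> CC then act w z y else 0)"
proof -
  obtain cell: "CC \<subseteq> W" "\<And>y z. \<lbrakk>y \<in> CC; z \<in> W\<rbrakk> \<Longrightarrow> z \<in> CC \<longleftrightarrow> sim_L G S H z y"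
    using left_cellE[OF assms(1)] by metis
  have "sim_L G S H z y \<longleftrightarrow> y \<in> CC \<and> z \<in> CC"
    using cell(2)[of y z] cell(2)[of z y] sim_L_sym assms(2-4) by blast
  then show ?thesis by (simp add: gact_def)
qed

text \<open>Any block of a matrix commuting with the block diagonal \<open>gact\<close> intertwines
  the corresponding cell modules.\<close>

lemma rmult_in_Hom_W:
  assumes "CC \<in> left_cells G S H" "CC' \<in> left_cells G S H" "x \<in> W"
  shows "mat_hom CC CC' (rmult x) \<in> Hom_W G H CC CC'"
proof (rule mat_hom_in_Hom_W)
  show sub: "CC \<subseteq> W" "CC' \<subseteq> W" using left_cellE assms(1,2) by metis+
  fix w z y assume *: "w \<in> W" "z \<in> CC'" "y \<in> CC"
  then have W: "z \<in> W" "y \<in> W" using sub by auto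
  have "(\<Sum>t\<in>CC. rmult x z t * act w t y) = (\<Sum>t\<in>W. rmult x z t * gact w t y)"
    by (rule sum.mono_neutral_cong_left)
      (use sub W * finite_W in \<open>auto simp: gact_left_cell[OF assms(1)]\<close>)
  also have "\<dots> = (\<Sum>t\<in>W. gact w z t * rmult x t y)"
    by (rule gact_commute[symmetric]) (use * W assms(3) in auto)
  also have "\<dots> = (\<Sum>t\<in>CC'. act w z t * rmult x t y)"
    by (rule sum.mono_neutral_cong_right)
      (use sub W * finite_W in \<open>auto simp: gact_left_cell[OF assms(2)]\<close>)
  finally show "(\<Sum>t\<in>CC. rmult x z t * act w t y) = (\<Sum>t\<in>CC'. act w z t * rmult x t y)" .
qed

lemma coeff_sum_hom_scale:
  assumes "CC' \<subseteq> W" "m \<in> free_mod CC" "z \<in> CC'"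
  shows "coeff ((\<Sum>x\<in>X. hom_scale (c x) (mat_hom CC CC' (rmult x))) m) z
    = (\<Sum>x\<in>X. c x * (\<Sum>y\<in>CC. rmult x z y * coeff m y))"
  using assms
  by (simp add: sum_fun_apply hom_scale_def Poly_Mapping.lookup_sum lookup_scale coeff_mat_hom)

text \<open>Extended by zero, a homomorphism becomes an endomorphism of the whole graded module, to
  which \<open>commutant_rmult\<close> applies; \<open>rmult_cells\<close> then discards all x
  outside the index set.\<close>

lemma Hom_W_span:
  assumes "CC \<in> left_cells G S H" "CC' \<in> left_cells G S H" "\<phi> \<in> Hom_W G H CC CC'"
  obtains c where
    "\<phi> = (\<Sum>x\<in>{x \<in> CC'. inv x \<in> CC}. hom_scale (c x) (mat_hom CC CC' (rmult x)))"
proof -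
  let ?X = "{x \<in> CC'. inv x \<in> CC}"
  have sub: "CC \<subseteq> W" "CC' \<subseteq> W" using left_cellE assms(1,2) by metis+
  note cell = gact_left_cell[OF assms(1)] and cell' = gact_left_cell[OF assms(2)]
  define F where "F z y = coeff (\<phi> (Poly_Mapping.single y 1)) z" for z y
  have \<phi>: "\<phi> = mat_hom CC CC' F"
    unfolding F_def by (rule Hom_W_eq_mat_hom[OF sub assms(3)])
  have F: "(\<Sum>t\<in>CC. F z t * act w t y) = (\<Sum>t\<in>CC'. act w z t * F t y)"
    if "w \<in> W" "z \<in> CC'" "y \<in> CC" for w z y
    unfolding F_def by (rule Hom_W_matrix_equivariant[OF sub assms(3) that])
  define F0 where "F0 z y = (if z \<in> CC' \<and> y \<in> CC then F z y else 0)" for z y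
  have F0: "(\<Sum>t\<in>W. F0 z t * gact w t y) = (\<Sum>t\<in>W. gact w z t * F0 t y)"
    if *: "w \<in> W" "z \<in> W" "y \<in> W" for w z y
  proof (cases "z \<in> CC' \<and> y \<in> CC")
    case True
    have "(\<Sum>t\<in>W. F0 z t * gact w t y) = (\<Sum>t\<in>CC. F z t * act w t y)"
      by (rule sum.mono_neutral_cong_right)
        (use sub * True finite_W in \<open>auto simp: F0_def cell\<close>)
    moreover have "(\<Sum>t\<in>W. gact w z t * F0 t y) = (\<Sum>t\<in>CC'. act w z t * F t y)"
      by (rule sum.mono_neutral_cong_right)
        (use sub * True finite_W in \<open>auto simp: F0_def cell'\<close>)
    ultimately show ?thesis using F * True by simp
  next
    case False
    have "F0 z t * gact w t y = 0" if "t \<in> W" for t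
      using False * that by (auto simp: F0_def cell)
    moreover have "gact w z t * F0 t y = 0" if "t \<in> W" for t
      using False * that by (auto simp: F0_def cell')
    ultimately show ?thesis by (simp only: sum.neutral_const cong: sum.cong)
  qed
  define c where "c x = (\<Sum>d\<in>W. F0 x d * unit_J d)" for x
  have Fc: "F z y = (\<Sum>x\<in>?X. c x * rmult x z y)" if *: "z \<in> CC'" "y \<in> CC" for z y
  proof -
    have W: "z \<in> W" "y \<in> W" using * sub by auto
    have "F z y = F0 z y" using * by (simp add: F0_def)
    also have "\<dots> = (\<Sum>x\<in>W. c x * rmult x z y)"
      unfolding c_def by (rule commutant_rmult[OF F0 W])
    also have "\<dots> = (\<Sum>x\<in>?X. c x * rmult x z y)"
    proof (rule sum.mono_neutral_right)
      \<comment> \<open>A nonzero entry at \<open>z\<close> in \<open>CC'\<close> and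
        \<open>y\<close> in \<open>CC\<close> puts x into \<open>CC'\<close> and x^-1 into
        \<open>CC\<close>.\<close>
      show "\<forall>x\<in>W - ?X. c x * rmult x z y = 0"
      proof
        fix x assume x: "x \<in> W - ?X"
        have "x \<in> ?X" if r: "rmult x z y \<noteq> 0"
        proof -
          have "sim_L G S H x z" "sim_L G S H (inv x) y"
            using rmult_cells[of x z y] r x W sim_L_sym by auto
          moreover have "x \<in> W" "inv x \<in> W" using x by auto
          ultimately show ?thesis
            using left_cellE[OF assms(1)] left_cellE[OF assms(2)] * by (metis (mono_tags, lifting) mem_Collect_eq)
        qed
        then show "c x * rmult x z y = 0" using x by auto
      qed
    qed (use sub finite_W in auto)
    finally show ?thesis .
  qed
  have "\<phi> = (\<Sum>x\<in>?X. hom_scale (c x) (mat_hom CC CC' (rmult x)))"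
  proof (rule ext, rule poly_mapping_eqI)
    fix m z
    show "coeff (\<phi> m) z = coeff ((\<Sum>x\<in>?X. hom_scale (c x) (mat_hom CC CC' (rmult x))) m) z"
    proof (cases "m \<in> free_mod CC \<and> z \<in> CC'")
      case True
      have "(\<Sum>y\<in>CC. F z y * coeff m y) = (\<Sum>y\<in>CC. \<Sum>x\<in>?X. c x * (rmult x z y * coeff m y))"
        using True by (simp add: Fc sum_distrib_right mult.assoc)
      also have "\<dots> = (\<Sum>x\<in>?X. c x * (\<Sum>y\<in>CC. rmult x z y * coeff m y))"
        by (subst sum.swap) (simp add: sum_distrib_left)
      finally show ?thesis
        using True by (simp add: coeff_sum_hom_scale[OF sub(2)] \<phi> coeff_mat_hom[OF sub(2)])
    next
      case False
      then show ?thesis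
        by (auto simp: \<phi> coeff_mat_hom[OF sub(2)] sum_fun_apply hom_scale_def Poly_Mapping.lookup_sum
            lookup_scale)
    qed
  qed
  then show thesis by (rule that)
qed

text \<open>For the distinguished d of \<open>CC\<close> and x^-1 in \<open>CC\<close>, the product
  t_d t_x is a nonzero multiple of t_x. Evaluation at e_d therefore separates the right
  multiplications and proves their independence.\<close>

lemma dim_Hom_W_left_cells:
  assumes "CC \<in> left_cells G S H" "CC' \<in> left_cells G S H"
  shows "dim_Hom_W G H CC CC' = card (CC \<inter> m_inv G ` CC')"
proof -
  let ?X = "{x \<in> CC'. inv x \<in> CC}"
  let ?\<phi> = "\<lambda>x. mat_hom CC CC' (rmult x)"
  have sub: "CC \<subseteq> W" "CC' \<subseteq> W" using left_cellE assms(1,2) by metis+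
  have finX: "finite ?X" "finite CC" using finite_subset[OF sub(1) finite_W] finite_subset[OF sub(2) finite_W]
    by simp_all
  obtain d where "CC \<inter> dist_set G H = {d} \<and> (\<forall>x\<in>CC. gam G H (inv x) x d \<noteq> 0)"
    using P13[unfolded P13_def, rule_format, OF assms(1)] by (rule exE)
  then have d: "CC \<inter> dist_set G H = {d}" "\<And>x. x \<in> CC \<Longrightarrow> gam G H (inv x) x d \<noteq> 0"
    by auto
  have dCC: "d \<in> CC" "d \<in> dist_set G H" using d(1) by auto
  have coeff_d: "coeff ((\<Sum>x\<in>?X. hom_scale (c x) (?\<phi> x)) (Poly_Mapping.single d 1)) z
    = c z * of_int (gam G H z (inv z) d)" if z: "z \<in> ?X" for c z
  proof -
    have "(\<Sum>y\<in>CC. rmult x z y * coeff (Poly_Mapping.single d 1) y) = rmult x z d" for x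
      using dCC(1) finX(2)
      by (simp add: Poly_Mapping.lookup_single when_def if_distrib[of "\<lambda>c. _ * c"] sum.delta' cong: if_cong)
    then have "coeff ((\<Sum>x\<in>?X. hom_scale (c x) (?\<phi> x)) (Poly_Mapping.single d 1)) z
      = (\<Sum>x\<in>?X. c x * rmult x z d)"
      using z dCC(1) by (simp add: coeff_sum_hom_scale[OF sub(2)])
    also have "\<dots> = (\<Sum>x\<in>?X. if x = z then c x * of_int (gam G H x (inv x) d) else 0)"
      by (rule sum.cong[OF refl]) (use z sub dCC in \<open>auto simp: rmult_dist subset_iff\<close>)
    also have "\<dots> = c z * of_int (gam G H z (inv z) d)"
      using z finX(1) by (simp add: sum.delta)
    finally show ?thesis .
  qed
  \<comment> \<open>P13 is applied to z^-1, which lies in \<open>CC\<close>; this exchanges the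
    first two indices of gamma.\<close>
  have nonzero: "gam G H z (inv z) d \<noteq> 0" if "z \<in> ?X" for z
    using d(2)[of "inv z"] that sub(2) by auto
  have independent: "c z = 0" if "(\<Sum>x\<in>?X. hom_scale (c x) (?\<phi> x)) = 0" "z \<in> ?X" for c z
    using coeff_d[OF that(2), of c] nonzero[OF that(2)] unfolding that(1) by simp
  have inj: "inj_on ?\<phi> ?X"
  proof (rule inj_onI, rule ccontr)
    fix u w assume uw: "u \<in> ?X" "w \<in> ?X" "?\<phi> u = ?\<phi> w" "u \<noteq> w"
    define c where "c x = (if x = u then 1 else if x = w then - 1 else 0 :: complex)" for x
    have "(\<Sum>x\<in>?X. hom_scale (c x) (?\<phi> x)) = (\<Sum>x\<in>{u, w}. hom_scale (c x) (?\<phi> x))"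
      by (rule sum.mono_neutral_right) (use uw finX in \<open>auto simp: c_def hom_scale_def fun_eq_iff\<close>)
    also have "\<dots> = 0"
      using uw by (auto simp: c_def hom_scale_def fun_eq_iff scale_minus_left)
    finally have "c u = 0" using uw(1) by (rule independent)
    then show False by (simp add: c_def)
  qed
  have "vector_space.dim hom_scale (Hom_W G H CC CC') = card ?X"
  proof (rule hom_space.dim_unique)
    show "?\<phi> ` ?X \<subseteq> Hom_W G H CC CC'"
      using rmult_in_Hom_W[OF assms] sub by auto
    show "Hom_W G H CC CC' \<subseteq> hom_space.span (?\<phi> ` ?X)"
    proof
      fix \<psi> assume "\<psi> \<in> Hom_W G H CC CC'"
      then obtain c where c: "\<psi> = (\<Sum>x\<in>?X. hom_scale (c x) (?\<phi> x))"
        using Hom_W_span[OF assms] by blast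
      show "\<psi> \<in> hom_space.span (?\<phi> ` ?X)"
        unfolding c by (intro hom_space.span_sum hom_space.span_scale hom_space.span_base imageI)
    qed
    show "hom_space.independent (?\<phi> ` ?X)"
    proof (rule hom_space.independent_if_scalars_zero)
      fix f \<psi> assume s: "(\<Sum>\<psi>\<in>?\<phi> ` ?X. hom_scale (f \<psi>) \<psi>) = 0" and \<psi>: "\<psi> \<in> ?\<phi> ` ?X"
      have "(\<Sum>x\<in>?X. hom_scale (f (?\<phi> x)) (?\<phi> x)) = 0"
        using s by (simp only: sum.reindex[OF inj] o_def)
      then have "f (?\<phi> x) = 0" if "x \<in> ?X" for x
        using that by (rule independent[where c="\<lambda>x. f (?\<phi> x)"])
      with \<psi> show "f \<psi> = 0" by blast
    qed (use finX in simp)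
    show "card (?\<phi> ` ?X) = card ?X" using inj by (rule card_image)
  qed
  \<comment> \<open>The index set lies in \<open>CC'\<close>, the set to be counted lies in
    \<open>CC\<close>; inversion passes from one to the other.\<close>
  moreover have "bij_betw (m_inv G) ?X (CC \<inter> m_inv G ` CC')"
    by (rule bij_betwI[where g="m_inv G"]) (use sub in \<open>auto simp: subset_iff\<close>)
  ultimately show ?thesis
    unfolding dim_Hom_W_def using bij_betw_same_card by metis
qed

end

theorem lemma2p4:
  fixes G :: "('w, 'm) monoid_scheme"
    and S :: "'w set"
    and L :: "'w \<Rightarrow> int"
    and H :: "('w \<Rightarrow>\<^sub>0 laurent, 'n) ring_scheme"
    and CC CC' :: "'w set"
  assumes "coxeter_system G S"
    and "finite (carrier G)"
    and "positive_weight_function G S L"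
    and "hecke_algebra G S L H"
    and "P1_to_P15 G S H"
    and "CC \<in> left_cells G S H"
    and "CC' \<in> left_cells G S H"
  shows "dim_Hom_W G H CC CC' = card (CC \<inter> m_inv G ` CC')"
proof -
  interpret hecke_algebra G S L H by fact
  interpret lusztig_hecke_algebra G S L H
    by unfold_locales (use assms in \<open>simp_all add: positive_weight_function_def\<close>)
  show ?thesis using assms(6,7) by (rule dim_Hom_W_left_cells)
qed

end
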